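(* Let $\mu,\nu\in\mathcal P_1(\mathbb R)$ be such that $\mu\le_{cx}\nu$ and $\mu\ne\nu$. Then for all $Q\in\mathcal Q$, the lifted martingale coupling $\widehat M^Q(du,dx,dy)=\lambda_{(0,1)}(du)\,\delta_{F_\mu^{-1}(u)}(dx)\,\widetilde m^Q_u(dy)$ is a lifted martingale rearrangement coupling of the lifted Hoeffding-Fréchet coupling $\widehat\pi^{HF}(du,dx,dy)=\lambda_{(0,1)}(du)\,\delta_{F_\mu^{-1}(u)}(dx)\,\delta_{F_\nu^{-1}(u)}(dy)$, that is $$\forall Q\in\mathcal Q,\quad\widehat{\mathcal{AW}}_1(\widehat\pi^{HF},\widehat M^Q)=\inf_{\widehat M\in\widehat\Pi^{\mathrm M}(\mu,\nu)}\widehat{\mathcal{AW}}_1(\widehat\pi^{HF},\widehat M).$$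
   Context: **General notation.** $\mathcal P_1(\mathbb R)$ is the set of probability measures on $\mathbb R$ with finite first moment. $\Pi(\eta,\eta')$ is the set of couplings of $\eta$ and $\eta'$. $\mu\le_{cx}\nu$ (convex order) means $\int f\,d\mu\le\int f\,d\nu$ for all convex $f:\mathbb R\to\mathbb R$. $F_\eta(x)=\eta((-\infty,x])$, $F_\eta^{-1}(u)=\inf\{x\in\mathbb R: F_\eta(x)\ge u\}$ for $u\in(0,1)$. $\mathcal W_1$ is the Wasserstein distance of order 1 on $\mathcal P_1(\mathbb R)$ for $|x-y|$. $\lambda_{(0,1)}$ is the Lebesgue measure on $(0,1)$. **Lifted couplings.** $\widehat\Pi(\mu,\nu)$ is the set of measures on $(0,1)\times\mathbb R\times\mathbb R$ of the form $\lambda_{(0,1)}(du)\,\delta_{F_\mu^{-1}(u)}(dx)\,p_u(dy)$, with $(p_u)_{u\in(0,1)}$ a probability kernel, whose third marginal is $\nu$. $\widehat\Pi^{\mathrm M}(\mu,\nu)$ is the subset of those with $\int_{\mathbb R}y\,p_u(dy)=F_\mu^{-1}(u)$ for $du$-almost all $u$. For $\widehat\pi=\lambda_{(0,1)}\times\delta_{F_\mu^{-1}(u)}\times p_u$ and $\widehat\pi'=\lambda_{(0,1)}\times\delta_{F_\mu^{-1}(u)}\times p'_u$ in $\widehat\Pi(\mu,\nu)$, $$\widehat{\mathcal{AW}}_1(\widehat\pi,\widehat\pi')=\inf_{\chi\in\Pi(\lambda_{(0,1)},\lambda_{(0,1)})}\int_{(0,1)^2}\left(|u-u'|+|F_\mu^{-1}(u)-F_\mu^{-1}(u')|+\mathcal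 W_1(p_u,p'_{u'})\right)\chi(du,du').$$ $\widehat M\in\widehat\Pi^{\mathrm M}(\mu,\nu)$ is a lifted martingale rearrangement coupling of $\widehat\pi$ if it minimises $\widehat{\mathcal{AW}}_1(\widehat\pi,\cdot)$ over $\widehat\Pi^{\mathrm M}(\mu,\nu)$. **The family $\mathcal Q$ and the kernels $\widetilde m^Q$.** For $u\in[0,1]$ let $\Psi_+(u)=\int_0^u(F_\mu^{-1}-F_\nu^{-1})^+(v)\,dv$ and $\Psi_-(u)=\int_0^u(F_\mu^{-1}-F_\nu^{-1})^-(v)\,dv$ (positive and negative parts); $\Psi_+(1)=\Psi_-(1)>0$. $\mathcal Q$ is the set of probability measures $Q$ on $(0,1)^2$ with first marginal $\frac1{\Psi_+(1)}d\Psi_+$, second marginal $\frac1{\Psi_+(1)}d\Psi_-$ and such that $u<v$ for $Q(du,dv)$-almost every $(u,v)$. As $d\Psi_+$ and $d\Psi_-$ are concentrated on disjoint Borel sets, for each $Q\in\mathcal Q$ there is a probability kernel $(\pi^Q_u)_{u\in(0,1)}$ on $(0,1)$ such that $$Q(du,dv)=\tfrac1{\Psi_+(1)}d\Psi_+(u)\,\pi^Q_u(dv)=\tfrac1{\Psi_+(1)}d\Psi_-(v)\,\pi^Q_v(du).$$ $(\widetilde m^Q_u)_{u\in(0,1)}$ is a probability kernel on $\mathbb R$ such that for $du$-almost all $u\in(0,1)$ with $F_\mu^{-1}(u)\neq F_\nu^{-1}(u)$, $$\widetilde m^Q_u(dy)=\int_{v\in(0,1)}\left(\frac{F_\mu^{-1}(u)-F_\nu^{-1}(u)}{F_\nu^{-1}(v)-F_\nu^{-1}(u)}\delta_{F_\nu^{-1}(v)}(dy)+\frac{F_\nu^{-1}(v)-F_\mu^{-1}(u)}{F_\nu^{-1}(v)-F_\nu^{-1}(u)}\delta_{F_\nu^{-1}(u)}(dy)\right)\pi^Q_u(dv),$$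 and $\widetilde m^Q_u=\delta_{F_\nu^{-1}(u)}$ for all $u$ with $F_\mu^{-1}(u)=F_\nu^{-1}(u)$. It is known that $\widehat M^Q\in\widehat\Pi^{\mathrm M}(\mu,\nu)$. *)

theory Defs
  imports "HOL-Probability.Probability"
begin

definition P1 :: "real measure set" where
  "P1 = {\<mu>. real_distribution \<mu> \<and> integrable \<mu> (\<lambda>x. x)}"

text \<open>The Bochner integral is 0 on non-integrable functions, whereas a convex function may have
  integral \<open>+\<infinity>\<close>. So the convex order is stated with the extended integral, which for
  measures in \<^const>\<open>P1\<close> and convex \<open>f\<close> never has the form \<open>\<infinity> - \<infinity>\<close>.\<close>

definition ext_integral :: "real measure \<Rightarrow> (real \<Rightarrow> real) \<Rightarrow> ereal" where
  "ext_integral M f =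
     enn2ereal (\<integral>\<^sup>+x. ennreal (f x) \<partial>M) - enn2ereal (\<integral>\<^sup>+x. ennreal (- f x) \<partial>M)"

definition convex_order :: "real measure \<Rightarrow> real measure \<Rightarrow> bool" where
  "convex_order \<mu> \<nu> \<longleftrightarrow> (\<forall>f. convex_on UNIV f \<longrightarrow> ext_integral \<mu> f \<le> ext_integral \<nu> f)"

definition quantile :: "real measure \<Rightarrow> real \<Rightarrow> real" where
  "quantile \<eta> u = Inf {x. u \<le> cdf \<eta> x}"

definition couplings :: "'a measure \<Rightarrow> 'b measure \<Rightarrow> ('a \<times> 'b) measure set" where
  "couplings \<eta> \<eta>' = {\<gamma>. sets \<gamma> = sets (\<eta> \<Otimes>\<^sub>M \<eta>') \<and> distr \<gamma> \<eta> fst = \<eta> \<and> distr \<gamma> \<eta>' snd = \<eta>'}"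

definition W1 :: "real measure \<Rightarrow> real measure \<Rightarrow> ennreal" where
  "W1 \<eta> \<eta>' = (INF \<gamma>\<in>couplings \<eta> \<eta>'. \<integral>\<^sup>+(x, y). ennreal \<bar>x - y\<bar> \<partial>\<gamma>)"

definition unif01 :: "real measure" where
  "unif01 = restrict_space lborel {0<..<1}"

text \<open>The measure \<open>\<lambda>\<^bsub>(0,1)\<^esub>(du) \<delta>\<^bsub>q(u)\<^esub>(dx) p\<^sub>u(dy)\<close>, where \<open>q\<close> is the quantile function of \<open>\<mu>\<close>.\<close>

definition lifted :: "real measure \<Rightarrow> (real \<Rightarrow> real measure) \<Rightarrow> (real \<times> real \<times> real) measure" where
  "lifted \<mu> p =
     bind unif01 (\<lambda>u. bind (return borel (quantile \<mu> u)) (\<lambda>x. bind (p u) (\<lambda>y.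
       return (unif01 \<Otimes>\<^sub>M borel \<Otimes>\<^sub>M borel) (u, x, y))))"

definition lifted_couplings ::
  "real measure \<Rightarrow> real measure \<Rightarrow> (real \<times> real \<times> real) measure set" where
  "lifted_couplings \<mu> \<nu> =
     {lifted \<mu> p | p. p \<in> unif01 \<rightarrow>\<^sub>M prob_algebra borel
        \<and> distr (lifted \<mu> p) borel (\<lambda>(u, x, y). y) = \<nu>}"

definition lifted_martingale_couplings ::
  "real measure \<Rightarrow> real measure \<Rightarrow> (real \<times> real \<times> real) measure set" where
  "lifted_martingale_couplings \<mu> \<nu> =
     {lifted \<mu> p | p. p \<in> unif01 \<rightarrow>\<^sub>M prob_algebra borel
        \<and> distr (lifted \<mu> p) borel (\<lambda>(u, x, y). y) = \<nu>
        \<and> (AE u in unif01. integrable (p u) (\<lambda>y. y) \<and> (\<integral>y. y \<partial>p u) = quantile \<mu> u)}"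

text \<open>The kernel of a lifted coupling is unique up to a Lebesgue-null set of \<open>u\<close>, so the choice
  made here does not affect \<open>lifted_AW1\<close> below.\<close>

definition lifted_kernel ::
  "real measure \<Rightarrow> (real \<times> real \<times> real) measure \<Rightarrow> real \<Rightarrow> real measure" where
  "lifted_kernel \<mu> \<pi> = (SOME p. p \<in> unif01 \<rightarrow>\<^sub>M prob_algebra borel \<and> \<pi> = lifted \<mu> p)"

definition lifted_AW1 ::
  "real measure \<Rightarrow> (real \<times> real \<times> real) measure \<Rightarrow> (real \<times> real \<times> real) measure \<Rightarrow> ennreal" where
  "lifted_AW1 \<mu> \<pi> \<pi>' =
     (INF \<gamma>\<in>couplings unif01 unif01. \<integral>\<^sup>+(u, u').
        ennreal \<bar>u - u'\<bar> + ennreal \<bar>quantile \<mu> u - quantile \<mu> u'\<bar>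
          + W1 (lifted_kernel \<mu> \<pi> u) (lifted_kernel \<mu> \<pi>' u') \<partial>\<gamma>)"

definition lifted_martingale_rearrangement ::
  "real measure \<Rightarrow> real measure \<Rightarrow> (real \<times> real \<times> real) measure \<Rightarrow> (real \<times> real \<times> real) measure \<Rightarrow> bool"
  where
  "lifted_martingale_rearrangement \<mu> \<nu> \<pi> M \<longleftrightarrow>
     \<pi> \<in> lifted_couplings \<mu> \<nu>
     \<and> is_arg_min (lifted_AW1 \<mu> \<pi>) (\<lambda>M'. M' \<in> lifted_martingale_couplings \<mu> \<nu>) M"

definition lifted_HF :: "real measure \<Rightarrow> real measure \<Rightarrow> (real \<times> real \<times> real) measure" where
  "lifted_HF \<mu> \<nu> = lifted \<mu> (\<lambda>u. return borel (quantile \<nu> u))"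

definition Psi_plus :: "real measure \<Rightarrow> real measure \<Rightarrow> real \<Rightarrow> real" where
  "Psi_plus \<mu> \<nu> u = (LBINT v:{0<..<u}. max 0 (quantile \<mu> v - quantile \<nu> v))"

definition Psi_minus :: "real measure \<Rightarrow> real measure \<Rightarrow> real \<Rightarrow> real" where
  "Psi_minus \<mu> \<nu> u = (LBINT v:{0<..<u}. max 0 (- (quantile \<mu> v - quantile \<nu> v)))"

text \<open>The measures \<open>d\<Psi>\<^sub>+\<close> and \<open>d\<Psi>\<^sub>-\<close> on \<open>(0,1)\<close>; the two lemmas below state that their
  distribution functions are \<^const>\<open>Psi_plus\<close> and \<^const>\<open>Psi_minus\<close>.\<close>

definition dPsi_plus :: "real measure \<Rightarrow> real measure \<Rightarrow> real measure" where
  "dPsi_plus \<mu> \<nu> = density unif01 (\<lambda>u. ennreal (max 0 (quantile \<mu> u - quantile \<nu> u)))"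

definition dPsi_minus :: "real measure \<Rightarrow> real measure \<Rightarrow> real measure" where
  "dPsi_minus \<mu> \<nu> = density unif01 (\<lambda>u. ennreal (max 0 (- (quantile \<mu> u - quantile \<nu> u))))"

lemma emeasure_density_unif01:
  fixes f :: "real \<Rightarrow> real"
  assumes f: "set_integrable lborel {0<..<1} f" and u: "0 \<le> u" "u \<le> 1"
  shows "emeasure (density unif01 (\<lambda>v. ennreal (max 0 (f v)))) {0<..<u}
           = ennreal (LBINT v:{0<..<u}. max 0 (f v))"
proof -
  have fm: "f \<in> borel_measurable unif01"
    using f unfolding set_integrable_def unif01_def
    by (simp add: borel_measurable_restrict_space_iff borel_measurable_integrable)
  have I: "set_integrable lborel {0<..<u} f"
    by (rule set_integrable_subset[OF f]) (use u in auto)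
  have eq: "(\<lambda>v. indicat_real {0<..<u} v *\<^sub>R max 0 (f v)) = (\<lambda>v. max 0 (indicat_real {0<..<u} v *\<^sub>R f v))"
    by (auto simp: indicator_def)
  have I': "integrable lborel (\<lambda>v. indicat_real {0<..<u} v *\<^sub>R max 0 (f v))"
    unfolding eq using I unfolding set_integrable_def by auto
  have S: "{0<..<u} \<in> sets unif01"
    unfolding unif01_def using u by (auto simp: sets_restrict_space image_iff intro!: bexI[of _ "{0<..<u}"])
  have "emeasure (density unif01 (\<lambda>v. ennreal (max 0 (f v)))) {0<..<u}
        = (\<integral>\<^sup>+v. ennreal (max 0 (f v)) * indicator {0<..<u} v \<partial>unif01)"
    using fm S by (intro emeasure_density) auto
  also have "\<dots> = (\<integral>\<^sup>+v. ennreal (max 0 (f v)) * indicator {0<..<u} v * indicator {0<..<1} v \<partial>lborel)"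
    unfolding unif01_def by (subst nn_integral_restrict_space) auto
  also have "\<dots> = (\<integral>\<^sup>+v. ennreal (indicat_real {0<..<u} v *\<^sub>R max 0 (f v)) \<partial>lborel)"
    using u by (intro nn_integral_cong) (auto simp: indicator_def)
  also have "\<dots> = ennreal (LBINT v:{0<..<u}. max 0 (f v))"
    unfolding set_lebesgue_integral_def by (rule nn_integral_eq_integral[OF I']) auto
  finally show ?thesis .
qed

lemma
  assumes "set_integrable lborel {0<..<1} (\<lambda>v. quantile \<mu> v - quantile \<nu> v)" "0 \<le> u" "u \<le> 1"
  shows emeasure_dPsi_plus: "emeasure (dPsi_plus \<mu> \<nu>) {0<..<u} = ennreal (Psi_plus \<mu> \<nu> u)"
    and emeasure_dPsi_minus: "emeasure (dPsi_minus \<mu> \<nu>) {0<..<u} = ennreal (Psi_minus \<mu> \<nu> u)"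
proof -
  have "set_integrable lborel {0<..<1} (\<lambda>v. - (quantile \<mu> v - quantile \<nu> v))"
    using assms(1) unfolding set_integrable_def by (subst scaleR_minus_right) (rule integrable_minus)
  then show "emeasure (dPsi_minus \<mu> \<nu>) {0<..<u} = ennreal (Psi_minus \<mu> \<nu> u)"
    unfolding dPsi_minus_def Psi_minus_def using assms by (intro emeasure_density_unif01)
  show "emeasure (dPsi_plus \<mu> \<nu>) {0<..<u} = ennreal (Psi_plus \<mu> \<nu> u)"
    unfolding dPsi_plus_def Psi_plus_def using assms by (intro emeasure_density_unif01)
qed

text \<open>The normalising constant is \<open>\<Psi>\<^sub>+(1)\<close> in both cases; \<open>\<Psi>\<^sub>+(1) = \<Psi>\<^sub>-(1)\<close> under the
  convex order.\<close>

definition normalized_dPsi_plus :: "real measure \<Rightarrow> real measure \<Rightarrow> real measure" where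
  "normalized_dPsi_plus \<mu> \<nu> = scale_measure (ennreal (1 / Psi_plus \<mu> \<nu> 1)) (dPsi_plus \<mu> \<nu>)"

definition normalized_dPsi_minus :: "real measure \<Rightarrow> real measure \<Rightarrow> real measure" where
  "normalized_dPsi_minus \<mu> \<nu> = scale_measure (ennreal (1 / Psi_plus \<mu> \<nu> 1)) (dPsi_minus \<mu> \<nu>)"

definition Qset :: "real measure \<Rightarrow> real measure \<Rightarrow> (real \<times> real) measure set" where
  "Qset \<mu> \<nu> = {Q. prob_space Q \<and> sets Q = sets (unif01 \<Otimes>\<^sub>M unif01)
     \<and> distr Q unif01 fst = normalized_dPsi_plus \<mu> \<nu>
     \<and> distr Q unif01 snd = normalized_dPsi_minus \<mu> \<nu>
     \<and> (AE (u, v) in Q. u < v)}"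

text \<open>\<open>Q(du,dv) = \<Psi>\<^sub>+(1)\<inverse> d\<Psi>\<^sub>+(u) \<kappa>\<^sub>u(dv) = \<Psi>\<^sub>+(1)\<inverse> d\<Psi>\<^sub>-(v) \<kappa>\<^sub>v(du)\<close>\<close>

definition is_Q_kernel ::
  "real measure \<Rightarrow> real measure \<Rightarrow> (real \<times> real) measure \<Rightarrow> (real \<Rightarrow> real measure) \<Rightarrow> bool" where
  "is_Q_kernel \<mu> \<nu> Q \<kappa> \<longleftrightarrow> \<kappa> \<in> unif01 \<rightarrow>\<^sub>M prob_algebra unif01
     \<and> Q = bind (normalized_dPsi_plus \<mu> \<nu>)
            (\<lambda>u. bind (\<kappa> u) (\<lambda>v. return (unif01 \<Otimes>\<^sub>M unif01) (u, v)))
     \<and> Q = bind (normalized_dPsi_minus \<mu> \<nu>)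
            (\<lambda>v. bind (\<kappa> v) (\<lambda>u. return (unif01 \<Otimes>\<^sub>M unif01) (u, v)))"

text \<open>The mixture of Dirac masses is evaluated on Borel sets with a Bochner integral, because its
  weights lie in \<open>[0,1]\<close> only for \<open>\<kappa>\<^sub>u\<close>-almost every \<open>v\<close>.\<close>

definition is_mtilde ::
  "real measure \<Rightarrow> real measure \<Rightarrow> (real \<Rightarrow> real measure) \<Rightarrow> (real \<Rightarrow> real measure) \<Rightarrow> bool" where
  "is_mtilde \<mu> \<nu> \<kappa> m \<longleftrightarrow> m \<in> unif01 \<rightarrow>\<^sub>M prob_algebra borel
     \<and> (AE u in unif01. quantile \<mu> u \<noteq> quantile \<nu> u \<longrightarrow>
          (\<forall>A\<in>sets borel. measure (m u) A =
             (\<integral>v. (quantile \<mu> u - quantile \<nu> u) / (quantile \<nu> v - quantile \<nu> u)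
                    * indicator A (quantile \<nu> v)
                + (quantile \<nu> v - quantile \<mu> u) / (quantile \<nu> v - quantile \<nu> u)
                    * indicator A (quantile \<nu> u) \<partial>\<kappa> u)))
     \<and> (\<forall>u\<in>{0<..<1}. quantile \<mu> u = quantile \<nu> u \<longrightarrow> m u = return borel (quantile \<nu> u))"

end

theory Submission
  imports Defs
begin

text \<open>
  Write \<open>F\<close> and \<open>G\<close> for the quantile functions of \<open>\<mu>\<close> and \<open>\<nu>\<close>. Both sides of the claimed equality
  are \<open>\<integral> |F(u) - G(u)| du\<close>, which is a lower bound for the distance from the lifted
  Hoeffding-Frechet coupling to every lifted martingale coupling, and which the coupling built from
  \<open>Q\<close> attains.

  \<^emph>\<open>Lower bound.\<close> The distance of a Dirac mass to a probability measure is at least the distance of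
  its position to the mean. If \<open>p\<close> is the kernel of a lifted martingale coupling, then \<open>p\<^sub>v\<close> has mean
  \<open>F(v)\<close>, so \<open>|F(u) - F(v)| + W1(\<delta>\<^bsub>G(u)\<^esub>, p\<^sub>v) \<ge> |F(u) - F(v)| + |G(u) - F(v)| \<ge> |F(u) - G(u)|\<close>.
  Integrating over any coupling of the uniform law with itself removes \<open>v\<close> (\<open>lifted_AW1_HF_ge\<close>).

  \<^emph>\<open>Upper bound.\<close> With the diagonal coupling, the distance to \<open>lifted \<mu> m\<close> is at most
  \<open>\<integral> W1(\<delta>\<^bsub>G(u)\<^esub>, m\<^sub>u) du\<close>, and \<open>W1(\<delta>\<^bsub>G(u)\<^esub>, m\<^sub>u)\<close> is at most the mean of \<open>|y - G(u)|\<close> under \<open>m\<^sub>u\<close>.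
  Where \<open>F(u) \<noteq> G(u)\<close>, the measure \<open>m\<^sub>u\<close> is a \<open>\<kappa>\<^sub>u(dv)\<close>-mixture of two-point laws on \<open>G(u)\<close> and \<open>G(v)\<close>
  with mean \<open>F(u)\<close>. Almost all the \<open>G(v)\<close> lie on the same side of \<open>G(u)\<close>, namely the side of \<open>F(u)\<close>, so that this mean of
  \<open>|y - G(u)|\<close> is exactly \<open>|F(u) - G(u)|\<close> (\<open>mtilde_cost\<close>).

  \<^emph>\<open>Admissibility.\<close> That \<open>F(u)\<close> lies strictly between \<open>G(u)\<close> and \<open>G(v)\<close> holds because \<open>Q\<close> charges
  only pairs \<open>u < v\<close> with \<open>G(u) < F(u)\<close> and \<open>F(v) < G(v)\<close>, and \<open>F(u) \<le> F(v)\<close>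
  (\<open>kernel_straddles\<close>). This gives the martingale property. The third marginal of \<open>lifted \<mu> m\<close> is \<open>\<nu>\<close>
  because the mass which the points \<open>u\<close> with \<open>G(u) < F(u)\<close> move from \<open>G(u)\<close> to \<open>G(v)\<close> is the mass which
  the points \<open>v\<close> with \<open>F(v) < G(v)\<close> move from \<open>G(v)\<close> to \<open>G(u)\<close>: both equal the integral of
  \<open>1 / (G(v) - G(u))\<close> against the same multiple of \<open>Q\<close> (\<open>mtilde_marginal\<close>).

  The distance \<open>lifted_AW1\<close> refers to a kernel chosen for each lifted coupling. The kernel is almost
  everywhere unique (\<open>lifted_kernel_unique\<close>), which carries the bounds over to the chosen one.
\<close>

section \<open>The uniform law and quantile functions\<close>

lemma space_unif01 [simp]: "space unif01 = {0<..<1}"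
  by (simp add: unif01_def space_restrict_space)

lemma prob_space_unif01: "prob_space unif01"
  by (auto simp: unif01_def emeasure_restrict_space space_restrict_space intro!: prob_spaceI)

interpretation unif01: prob_space unif01
  by (rule prob_space_unif01)

lemma measurable_ident_unif01: "(\<lambda>u. u) \<in> borel_measurable unif01"
  unfolding unif01_def by (simp add: measurable_restrict_space1)

lemma
  assumes "real_distribution \<eta>"
  shows mono_on_quantile: "mono_on {0<..<1} (quantile \<eta>)"
    and measurable_quantile: "quantile \<eta> \<in> borel_measurable unif01"
    and distr_quantile: "distr unif01 borel (quantile \<eta>) = \<eta>"
proof -
  interpret cdf_distribution \<eta>
    using assms by (simp add: cdf_distribution_def)
  have eq: "quantile \<eta> = I"
    by (simp add: fun_eq_iff quantile_def)
  show "mono_on {0<..<1} (quantile \<eta>)"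
    unfolding eq by (rule mono_I)
  show "quantile \<eta> \<in> borel_measurable unif01"
    using measurable_CI unfolding eq unif01_def
    by (simp cong: measurable_cong_sets add: sets_restrict_space)
  show "distr unif01 borel (quantile \<eta>) = \<eta>"
    using distr_I_eq_M unfolding eq unif01_def .
qed

lemma prob_kernelD:
  assumes "p \<in> M \<rightarrow>\<^sub>M prob_algebra N" "u \<in> space M"
  shows "prob_space (p u)" "sets (p u) = sets N" "space (p u) = space N"
  using measurable_space[OF assms] sets_eq_imp_space_eq[of "p u" N]
  by (auto simp: space_prob_algebra)

lemma nn_integral_bind_return:
  assumes N: "sets N = sets L" and p: "p \<in> L \<rightarrow>\<^sub>M prob_algebra K"
    and T: "(\<lambda>(x, y). T x y) \<in> L \<Otimes>\<^sub>M K \<rightarrow>\<^sub>M R" and f: "f \<in> borel_measurable R"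
  shows "(\<integral>\<^sup>+z. f z \<partial>bind N (\<lambda>x. bind (p x) (\<lambda>y. return R (T x y))))
    = (\<integral>\<^sup>+x. \<integral>\<^sup>+y. f (T x y) \<partial>p x \<partial>N)"
proof -
  note [measurable_cong] = N
  note [measurable] = f T measurable_prob_algebraD[OF p]
  have "(\<integral>\<^sup>+z. f z \<partial>bind N (\<lambda>x. bind (p x) (\<lambda>y. return R (T x y))))
      = (\<integral>\<^sup>+x. \<integral>\<^sup>+z. f z \<partial>bind (p x) (\<lambda>y. return R (T x y)) \<partial>N)"
    by (rule nn_integral_bind[OF f]) measurable
  also have "\<dots> = (\<integral>\<^sup>+x. \<integral>\<^sup>+y. f (T x y) \<partial>p x \<partial>N)"
  proof (intro nn_integral_cong)
    fix x assume "x \<in> space N"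
    then have x [measurable]: "x \<in> space L"
      using sets_eq_imp_space_eq[OF N] by simp
    have "T x \<in> K \<rightarrow>\<^sub>M R"
      using measurable_Pair2[OF T x] by simp
    then have Tx: "T x \<in> p x \<rightarrow>\<^sub>M R"
      by (simp cong: measurable_cong_sets add: prob_kernelD(2)[OF p x])
    have "(\<integral>\<^sup>+z. f z \<partial>bind (p x) (\<lambda>y. return R (T x y)))
        = (\<integral>\<^sup>+y. \<integral>\<^sup>+z. f z \<partial>return R (T x y) \<partial>p x)"
      by (rule nn_integral_bind[OF f measurable_compose[OF Tx return_measurable]])
    also have "\<dots> = (\<integral>\<^sup>+y. f (T x y) \<partial>p x)"
      using measurable_space[OF Tx] f
      by (intro nn_integral_cong nn_integral_return) auto
    finally show "(\<integral>\<^sup>+z. f z \<partial>bind (p x) (\<lambda>y. return R (T x y))) = (\<integral>\<^sup>+y. f (T x y) \<partial>p x)" .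
  qed
  finally show ?thesis .
qed

section \<open>Lifted couplings and their kernels\<close>

text \<open>The middle coordinate is deterministic given \<open>u\<close>, so the Dirac kernel in the definition can be
  integrated out once and for all.\<close>

lemma lifted_eq:
  assumes \<mu>: "real_distribution \<mu>" and p: "p \<in> unif01 \<rightarrow>\<^sub>M prob_algebra borel"
  shows "lifted \<mu> p = bind unif01 (\<lambda>u. bind (p u)
           (\<lambda>y. return (unif01 \<Otimes>\<^sub>M borel \<Otimes>\<^sub>M borel) (u, quantile \<mu> u, y)))"
  unfolding lifted_def
proof (rule bind_cong[OF refl])
  fix u assume u: "u \<in> space unif01"
  show "return borel (quantile \<mu> u) \<bind>
      (\<lambda>x. p u \<bind> (\<lambda>y. return (unif01 \<Otimes>\<^sub>M borel \<Otimes>\<^sub>M borel) (u, x, y)))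
    = p u \<bind> (\<lambda>y. return (unif01 \<Otimes>\<^sub>M borel \<Otimes>\<^sub>M borel) (u, quantile \<mu> u, y))"
  proof (rule bind_return)
    have [measurable]: "(\<lambda>x::real. p u) \<in> borel \<rightarrow>\<^sub>M subprob_algebra borel"
      using measurable_space[OF measurable_prob_algebraD[OF p] u] by simp
    have [measurable]: "u \<in> space unif01" by (rule u)
    show "(\<lambda>x. p u \<bind> (\<lambda>y. return (unif01 \<Otimes>\<^sub>M borel \<Otimes>\<^sub>M borel) (u, x, y)))
      \<in> borel \<rightarrow>\<^sub>M subprob_algebra (unif01 \<Otimes>\<^sub>M borel \<Otimes>\<^sub>M borel)"
      by measurable
  qed simp
qed

lemma measurable_lifted_section:
  assumes \<mu>: "real_distribution \<mu>" and p: "p \<in> unif01 \<rightarrow>\<^sub>M prob_algebra borel"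
  shows "(\<lambda>u. bind (p u) (\<lambda>y. return (unif01 \<Otimes>\<^sub>M borel \<Otimes>\<^sub>M borel) (u, quantile \<mu> u, y)))
    \<in> unif01 \<rightarrow>\<^sub>M subprob_algebra (unif01 \<Otimes>\<^sub>M borel \<Otimes>\<^sub>M borel)"
proof -
  note [measurable] = measurable_quantile[OF \<mu>] measurable_prob_algebraD[OF p]
  show ?thesis by measurable
qed

lemma sets_lifted:
  assumes "real_distribution \<mu>" and "p \<in> unif01 \<rightarrow>\<^sub>M prob_algebra borel"
  shows "sets (lifted \<mu> p) = sets (unif01 \<Otimes>\<^sub>M borel \<Otimes>\<^sub>M borel)"
  unfolding lifted_eq[OF assms]
  by (intro sets_bind_measurable[OF measurable_lifted_section[OF assms]]) simp

lemma nn_integral_lifted: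
  assumes \<mu>: "real_distribution \<mu>" and p: "p \<in> unif01 \<rightarrow>\<^sub>M prob_algebra borel"
    and f: "f \<in> borel_measurable (unif01 \<Otimes>\<^sub>M borel \<Otimes>\<^sub>M borel)"
  shows "(\<integral>\<^sup>+z. f z \<partial>lifted \<mu> p) = (\<integral>\<^sup>+u. \<integral>\<^sup>+y. f (u, quantile \<mu> u, y) \<partial>p u \<partial>unif01)"
  unfolding lifted_eq[OF \<mu> p]
proof (rule nn_integral_bind_return[OF refl p _ f])
  note [measurable] = measurable_quantile[OF \<mu>]
  show "(\<lambda>(u, y). (u, quantile \<mu> u, y)) \<in> unif01 \<Otimes>\<^sub>M borel \<rightarrow>\<^sub>M unif01 \<Otimes>\<^sub>M borel \<Otimes>\<^sub>M borel"
    by measurable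
qed

lemma emeasure_third_marginal_lifted:
  assumes \<mu>: "real_distribution \<mu>" and p: "p \<in> unif01 \<rightarrow>\<^sub>M prob_algebra borel" and A: "A \<in> sets borel"
  shows "emeasure (distr (lifted \<mu> p) borel (\<lambda>(u, x, y). y)) A = (\<integral>\<^sup>+u. emeasure (p u) A \<partial>unif01)"
proof -
  note [measurable] = A
  note [measurable_cong] = sets_lifted[OF \<mu> p]
  have "emeasure (distr (lifted \<mu> p) borel (\<lambda>(u, x, y). y)) A
      = (\<integral>\<^sup>+z. indicator A z \<partial>distr (lifted \<mu> p) borel (\<lambda>(u, x, y). y))"
    by simp
  also have "\<dots> = (\<integral>\<^sup>+z. indicator A (snd (snd z)) \<partial>lifted \<mu> p)"
    by (subst nn_integral_distr) (auto simp: case_prod_unfold)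
  also have "\<dots> = (\<integral>\<^sup>+u. \<integral>\<^sup>+y. indicator A y \<partial>p u \<partial>unif01)"
    by (subst nn_integral_lifted[OF \<mu> p]) auto
  also have "\<dots> = (\<integral>\<^sup>+u. emeasure (p u) A \<partial>unif01)"
    using prob_kernelD[OF p] A by (intro nn_integral_cong nn_integral_indicator) auto
  finally show ?thesis .
qed

text \<open>Countably many values of the distribution function suffice by right continuity; the countability
  is what allows exceptional null sets to be united in the uniqueness of kernels.\<close>

lemma real_distribution_eqI_rat:
  assumes M: "real_distribution M" and N: "real_distribution N"
    and eq: "\<And>q::rat. cdf M (of_rat q) = cdf N (of_rat q)"
  shows "M = N"
proof (rule cdf_unique[OF M N ext])
  have le: "cdf M' x \<le> cdf N' x"
    if M': "real_distribution M'" and N': "real_distribution N'"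
      and eq: "\<And>q::rat. cdf M' (of_rat q) = cdf N' (of_rat q)" for M' N' x
  proof (rule ccontr)
    interpret M': real_distribution M' by fact
    interpret N': real_distribution N' by fact
    assume "\<not> cdf M' x \<le> cdf N' x"
    then have "cdf N' x < cdf M' x" by simp
    moreover have "(cdf N' \<longlongrightarrow> cdf N' x) (at_right x)"
      using N'.cdf_is_right_cont[of x] by (simp add: continuous_within)
    ultimately have "eventually (\<lambda>z. cdf N' z < cdf M' x) (at_right x)"
      by (simp add: order_tendstoD)
    then obtain y where "x < y" and y: "\<And>z. x < z \<Longrightarrow> z < y \<Longrightarrow> cdf N' z < cdf M' x"
      by (auto simp: eventually_at_right[of x "x + 1"])
    obtain q where "x < of_rat q" "of_rat q < y"
      using of_rat_dense[OF \<open>x < y\<close>] by auto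
    then show False
      using y[of "of_rat q"] eq[of q] M'.cdf_nondecreasing[of x "of_rat q"] by simp
  qed
  fix x show "cdf M x = cdf N x"
    using le[OF M N] le[OF N M] eq by (metis order.antisym)
qed

text \<open>For fixed rational \<open>q\<close>, testing the lifted measures on \<open>B \<times> \<real> \<times> {..q}\<close> for all Borel \<open>B\<close>
  identifies \<open>p\<^sub>u {..q}\<close> for almost all \<open>u\<close>.\<close>

lemma lifted_kernel_unique:
  assumes \<mu>: "real_distribution \<mu>"
    and p: "p \<in> unif01 \<rightarrow>\<^sub>M prob_algebra borel" and p': "p' \<in> unif01 \<rightarrow>\<^sub>M prob_algebra borel"
    and eq: "lifted \<mu> p = lifted \<mu> p'"
  shows "AE u in unif01. p u = p' u"
proof -
  have "AE u in unif01. emeasure (p u) {..of_rat q} = emeasure (p' u) {..of_rat q}" for q :: rat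
  proof (rule unif01.density_unique_finite_measure)
    fix B assume [measurable]: "B \<in> sets unif01"
    have *: "(\<integral>\<^sup>+u. emeasure (r u) {..of_rat q} * indicator B u \<partial>unif01)
        = (\<integral>\<^sup>+z. indicator B (fst z) * indicator {..of_rat q} (snd (snd z)) \<partial>lifted \<mu> r)"
      if r: "r \<in> unif01 \<rightarrow>\<^sub>M prob_algebra borel" for r
    proof -
      have "(\<integral>\<^sup>+z. indicator B (fst z) * indicator {..of_rat q} (snd (snd z)) \<partial>lifted \<mu> r)
        = (\<integral>\<^sup>+u. \<integral>\<^sup>+y. indicator B u * indicator {..of_rat q} y \<partial>r u \<partial>unif01)"
        by (subst nn_integral_lifted[OF \<mu> r]) auto
      also have "\<dots> = (\<integral>\<^sup>+u. emeasure (r u) {..of_rat q} * indicator B u \<partial>unif01)"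
      proof (intro nn_integral_cong)
        fix u assume u: "u \<in> space unif01"
        note [measurable_cong] = prob_kernelD(2)[OF r u]
        show "(\<integral>\<^sup>+y. indicator B u * indicator {..of_rat q} y \<partial>r u)
          = emeasure (r u) {..of_rat q} * indicator B u"
          by (subst nn_integral_cmult) (auto simp: mult.commute)
      qed
      finally show ?thesis by simp
    qed
    show "(\<integral>\<^sup>+u. emeasure (p u) {..of_rat q} * indicator B u \<partial>unif01)
        = (\<integral>\<^sup>+u. emeasure (p' u) {..of_rat q} * indicator B u \<partial>unif01)"
      using *[OF p] *[OF p'] eq by simp
  next
    show "(\<lambda>u. emeasure (p u) {..of_rat q}) \<in> borel_measurable unif01"
      "(\<lambda>u. emeasure (p' u) {..of_rat q}) \<in> borel_measurable unif01"
      using measurable_prob_algebraD[OF p] measurable_prob_algebraD[OF p'] by measurable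
  qed auto
  then have "AE u in unif01. \<forall>q::rat. emeasure (p u) {..of_rat q} = emeasure (p' u) {..of_rat q}"
    by (simp add: AE_all_countable)
  then show ?thesis
    using AE_space
  proof eventually_elim
    fix u assume eq: "\<forall>q::rat. emeasure (p u) {..of_rat q} = emeasure (p' u) {..of_rat q}"
      and u: "u \<in> space unif01"
    have "real_distribution (p u)" "real_distribution (p' u)"
      using prob_kernelD[OF p u] prob_kernelD[OF p' u]
      by (auto simp: real_distribution_def real_distribution_axioms_def)
    then show "p u = p' u"
      by (rule real_distribution_eqI_rat) (simp add: cdf_def measure_def eq)
  qed
qed

lemma lifted_kernel_AE_eq:
  assumes \<mu>: "real_distribution \<mu>" and p: "p \<in> unif01 \<rightarrow>\<^sub>M prob_algebra borel"
  shows "AE u in unif01. lifted_kernel \<mu> (lifted \<mu> p) u = p u"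
proof -
  have "lifted_kernel \<mu> (lifted \<mu> p) \<in> unif01 \<rightarrow>\<^sub>M prob_algebra borel
      \<and> lifted \<mu> p = lifted \<mu> (lifted_kernel \<mu> (lifted \<mu> p))"
    unfolding lifted_kernel_def
    by (rule someI[where P="\<lambda>q. q \<in> unif01 \<rightarrow>\<^sub>M prob_algebra borel \<and> lifted \<mu> p = lifted \<mu> q" and x=p])
      (simp add: p)
  then show ?thesis
    using lifted_kernel_unique[OF \<mu> _ p] by metis
qed

section \<open>Wasserstein distance to a Dirac mass\<close>

text \<open>These transfers are stated for arbitrary predicates: the sets to which they are applied
  involve the chosen kernels and need not be obviously measurable.\<close>

lemma coupling_AE:
  assumes \<gamma>: "\<gamma> \<in> couplings \<eta> \<eta>'"
  shows "AE u in \<eta>. P u \<Longrightarrow> AE z in \<gamma>. P (fst z)"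
    and "AE u in \<eta>'. P' u \<Longrightarrow> AE z in \<gamma>. P' (snd z)"
proof -
  have [measurable_cong]: "sets \<gamma> = sets (\<eta> \<Otimes>\<^sub>M \<eta>')" using \<gamma> by (simp add: couplings_def)
  have d: "distr \<gamma> \<eta> fst = \<eta>" "distr \<gamma> \<eta>' snd = \<eta>'" using \<gamma> by (simp_all add: couplings_def)
  show "AE u in \<eta>. P u \<Longrightarrow> AE z in \<gamma>. P (fst z)"
    by (rule AE_distrD[of fst \<gamma> \<eta>]) (simp, simp only: d)
  show "AE u in \<eta>'. P' u \<Longrightarrow> AE z in \<gamma>. P' (snd z)"
    by (rule AE_distrD[of snd \<gamma> \<eta>']) (simp, simp only: d)
qed

lemma coupling_nn_integral_fst:
  assumes \<gamma>: "\<gamma> \<in> couplings \<eta> \<eta>'" and [measurable]: "f \<in> borel_measurable \<eta>"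
  shows "(\<integral>\<^sup>+z. f (fst z) \<partial>\<gamma>) = (\<integral>\<^sup>+x. f x \<partial>\<eta>)"
proof -
  have [measurable_cong]: "sets \<gamma> = sets (\<eta> \<Otimes>\<^sub>M \<eta>')" using \<gamma> by (simp add: couplings_def)
  have "(\<integral>\<^sup>+z. f (fst z) \<partial>\<gamma>) = (\<integral>\<^sup>+x. f x \<partial>distr \<gamma> \<eta> fst)"
    by (rule nn_integral_distr[symmetric]) auto
  then show ?thesis using \<gamma> by (simp add: couplings_def)
qed

lemma coupling_nn_integral_snd:
  assumes \<gamma>: "\<gamma> \<in> couplings \<eta> \<eta>'" and [measurable]: "f \<in> borel_measurable \<eta>'"
  shows "(\<integral>\<^sup>+z. f (snd z) \<partial>\<gamma>) = (\<integral>\<^sup>+x. f x \<partial>\<eta>')"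
proof -
  have [measurable_cong]: "sets \<gamma> = sets (\<eta> \<Otimes>\<^sub>M \<eta>')" using \<gamma> by (simp add: couplings_def)
  have "(\<integral>\<^sup>+z. f (snd z) \<partial>\<gamma>) = (\<integral>\<^sup>+x. f x \<partial>distr \<gamma> \<eta>' snd)"
    by (rule nn_integral_distr[symmetric]) auto
  then show ?thesis using \<gamma> by (simp add: couplings_def)
qed

text \<open>Any coupling with a Dirac mass at \<open>a\<close> costs \<open>\<integral> |a - y| dp\<close>, and Jensen bounds this below.\<close>

lemma W1_return_ge_mean:
  assumes p: "prob_space p" "sets p = sets borel" and int: "integrable p (\<lambda>y. y)"
  shows "ennreal \<bar>a - (\<integral>y. y \<partial>p)\<bar> \<le> W1 (return borel a) p"
  unfolding W1_def
proof (rule INF_greatest)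
  interpret prob_space p by fact
  note [measurable_cong] = p(2)
  fix \<gamma> assume \<gamma>: "\<gamma> \<in> couplings (return borel a) p"
  have "\<bar>a - (\<integral>y. y \<partial>p)\<bar> = \<bar>\<integral>y. a - y \<partial>p\<bar>"
    using int by (simp add: prob_space)
  also have "\<dots> \<le> (\<integral>y. \<bar>a - y\<bar> \<partial>p)"
    by (rule integral_abs_bound)
  finally have "ennreal \<bar>a - (\<integral>y. y \<partial>p)\<bar> \<le> ennreal (\<integral>y. \<bar>a - y\<bar> \<partial>p)"
    by (rule ennreal_leI)
  also have "\<dots> = (\<integral>\<^sup>+y. ennreal \<bar>a - y\<bar> \<partial>p)"
    using int by (intro nn_integral_eq_integral[symmetric]) auto
  also have "\<dots> = (\<integral>\<^sup>+z. ennreal \<bar>a - snd z\<bar> \<partial>\<gamma>)"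
    by (rule coupling_nn_integral_snd[OF \<gamma>, symmetric]) measurable
  also have "\<dots> = (\<integral>\<^sup>+z. ennreal \<bar>fst z - snd z\<bar> \<partial>\<gamma>)"
  proof (rule nn_integral_cong_AE)
    have "AE x in return borel a. x = a"
      by (simp add: AE_return)
    then show "AE z in \<gamma>. ennreal \<bar>a - snd z\<bar> = ennreal \<bar>fst z - snd z\<bar>"
      by (rule coupling_AE(1)[OF \<gamma>, THEN eventually_mono]) auto
  qed
  finally show "ennreal \<bar>a - (\<integral>y. y \<partial>p)\<bar> \<le> (\<integral>\<^sup>+(x, y). ennreal \<bar>x - y\<bar> \<partial>\<gamma>)"
    by (simp add: case_prod_unfold)
qed

lemma W1_return_le:
  assumes p: "prob_space p" "sets p = sets borel"
  shows "W1 (return borel a) p \<le> (\<integral>\<^sup>+y. ennreal \<bar>y - a\<bar> \<partial>p)"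
proof -
  interpret prob_space p by fact
  note [measurable_cong] = p(2)
  define \<gamma> where "\<gamma> = distr p (return borel a \<Otimes>\<^sub>M p) (\<lambda>y. (a, y))"
  have "\<gamma> \<in> couplings (return borel a) p"
    unfolding couplings_def
  proof (intro CollectI conjI)
    show "sets \<gamma> = sets (return borel a \<Otimes>\<^sub>M p)" by (simp add: \<gamma>_def)
    have "distr \<gamma> (return borel a) fst = distr p (return borel a) (\<lambda>y. a)"
      unfolding \<gamma>_def
      by (subst distr_distr[OF measurable_fst]) (auto simp: comp_def intro!: measurable_Pair)
    also have "\<dots> = return borel a"
    proof (rule measure_eqI)
      fix A assume "A \<in> sets (distr p (return borel a) (\<lambda>y. a))"
      then have [measurable]: "A \<in> sets borel" by simp
      show "emeasure (distr p (return borel a) (\<lambda>y. a)) A = emeasure (return borel a) A"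
        using emeasure_space_1 sets_eq_imp_space_eq[OF p(2)]
        by (subst emeasure_distr) (auto simp: indicator_def)
    qed simp
    finally show "distr \<gamma> (return borel a) fst = return borel a" .
    show "distr \<gamma> p snd = p"
      unfolding \<gamma>_def by (subst distr_distr) (auto simp: comp_def distr_id)
  qed
  then have "W1 (return borel a) p \<le> (\<integral>\<^sup>+(x, y). ennreal \<bar>x - y\<bar> \<partial>\<gamma>)"
    unfolding W1_def by (rule INF_lower)
  also have "\<dots> = (\<integral>\<^sup>+y. ennreal \<bar>y - a\<bar> \<partial>p)"
  proof -
    have [measurable_cong]: "sets (return borel a \<Otimes>\<^sub>M p) = sets (borel \<Otimes>\<^sub>M borel)"
      by (intro sets_pair_measure_cong) (auto simp: p)
    show ?thesis
      unfolding \<gamma>_def by (subst nn_integral_distr) (auto simp: abs_minus_commute)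
  qed
  finally show ?thesis .
qed

section \<open>Bounds for the adapted distance to the Hoeffding-Frechet coupling\<close>

lemma measurable_return_quantile:
  assumes "real_distribution \<nu>"
  shows "(\<lambda>u. return borel (quantile \<nu> u)) \<in> unif01 \<rightarrow>\<^sub>M prob_algebra borel"
  using measurable_quantile[OF assms] by measurable

lemma lifted_HF_kernel_AE:
  assumes "real_distribution \<mu>" "real_distribution \<nu>"
  shows "AE u in unif01. lifted_kernel \<mu> (lifted_HF \<mu> \<nu>) u = return borel (quantile \<nu> u)"
  unfolding lifted_HF_def
  by (rule lifted_kernel_AE_eq[OF assms(1) measurable_return_quantile[OF assms(2)]])

lemma lifted_HF_in_couplings:
  assumes \<mu>: "real_distribution \<mu>" and \<nu>: "real_distribution \<nu>"
  shows "lifted_HF \<mu> \<nu> \<in> lifted_couplings \<mu> \<nu>"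
proof -
  note [measurable] = measurable_quantile[OF \<nu>]
  note p = measurable_return_quantile[OF \<nu>]
  interpret \<nu>: real_distribution \<nu> by fact
  have "distr (lifted_HF \<mu> \<nu>) borel (\<lambda>(u, x, y). y) = \<nu>"
  proof (rule measure_eqI)
    fix A assume "A \<in> sets (distr (lifted_HF \<mu> \<nu>) borel (\<lambda>(u, x, y). y))"
    then have [measurable]: "A \<in> sets borel" by simp
    have "emeasure (distr (lifted_HF \<mu> \<nu>) borel (\<lambda>(u, x, y). y)) A
        = (\<integral>\<^sup>+u. indicator A (quantile \<nu> u) \<partial>unif01)"
      unfolding lifted_HF_def by (simp add: emeasure_third_marginal_lifted[OF \<mu> p])
    also have "\<dots> = (\<integral>\<^sup>+x. indicator A x \<partial>distr unif01 borel (quantile \<nu>))"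
      by (rule nn_integral_distr[symmetric]) auto
    finally show "emeasure (distr (lifted_HF \<mu> \<nu>) borel (\<lambda>(u, x, y). y)) A = emeasure \<nu> A"
      by (simp add: distr_quantile[OF \<nu>])
  qed simp
  then show ?thesis
    unfolding lifted_couplings_def lifted_HF_def using p by blast
qed

text \<open>The term \<open>|u - u'|\<close> is dropped; the other two combine by the triangle inequality through the
  barycentre \<open>F(u')\<close> of the second kernel.\<close>

lemma lifted_AW1_HF_ge:
  assumes \<mu>: "real_distribution \<mu>" and \<nu>: "real_distribution \<nu>"
    and M: "M \<in> lifted_martingale_couplings \<mu> \<nu>"
  shows "(\<integral>\<^sup>+u. ennreal \<bar>quantile \<mu> u - quantile \<nu> u\<bar> \<partial>unif01) \<le> lifted_AW1 \<mu> (lifted_HF \<mu> \<nu>) M"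
  unfolding lifted_AW1_def
proof (rule INF_greatest)
  note [measurable] = measurable_quantile[OF \<mu>] measurable_quantile[OF \<nu>]
  from M obtain p where p: "p \<in> unif01 \<rightarrow>\<^sub>M prob_algebra borel" and M: "M = lifted \<mu> p"
    and mart: "AE u in unif01. integrable (p u) (\<lambda>y. y) \<and> (\<integral>y. y \<partial>p u) = quantile \<mu> u"
    unfolding lifted_martingale_couplings_def by blast
  fix \<gamma> assume \<gamma>: "\<gamma> \<in> couplings unif01 unif01"
  let ?c = "\<lambda>u u'. ennreal \<bar>u - u'\<bar> + ennreal \<bar>quantile \<mu> u - quantile \<mu> u'\<bar>
    + W1 (lifted_kernel \<mu> (lifted_HF \<mu> \<nu>) u) (lifted_kernel \<mu> M u')"
  have HF: "AE z in \<gamma>. lifted_kernel \<mu> (lifted_HF \<mu> \<nu>) (fst z) = return borel (quantile \<nu> (fst z))"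
    by (rule coupling_AE(1)[OF \<gamma> lifted_HF_kernel_AE[OF \<mu> \<nu>]])
  have "AE u in unif01. prob_space (lifted_kernel \<mu> M u) \<and> sets (lifted_kernel \<mu> M u) = sets borel
      \<and> integrable (lifted_kernel \<mu> M u) (\<lambda>y. y) \<and> (\<integral>y. y \<partial>lifted_kernel \<mu> M u) = quantile \<mu> u"
    using lifted_kernel_AE_eq[OF \<mu> p] mart AE_space
    by eventually_elim (use prob_kernelD[OF p] M in auto)
  from coupling_AE(2)[OF \<gamma> this]
  have K: "AE z in \<gamma>. prob_space (lifted_kernel \<mu> M (snd z))
      \<and> sets (lifted_kernel \<mu> M (snd z)) = sets borel
      \<and> integrable (lifted_kernel \<mu> M (snd z)) (\<lambda>y. y)
      \<and> (\<integral>y. y \<partial>lifted_kernel \<mu> M (snd z)) = quantile \<mu> (snd z)" .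
  have "(\<integral>\<^sup>+u. ennreal \<bar>quantile \<mu> u - quantile \<nu> u\<bar> \<partial>unif01)
      = (\<integral>\<^sup>+z. ennreal \<bar>quantile \<mu> (fst z) - quantile \<nu> (fst z)\<bar> \<partial>\<gamma>)"
    by (rule coupling_nn_integral_fst[OF \<gamma>, symmetric]) measurable
  also have "\<dots> \<le> (\<integral>\<^sup>+z. ?c (fst z) (snd z) \<partial>\<gamma>)"
  proof (rule nn_integral_mono_AE)
    from HF K show "AE z in \<gamma>. ennreal \<bar>quantile \<mu> (fst z) - quantile \<nu> (fst z)\<bar> \<le> ?c (fst z) (snd z)"
    proof eventually_elim
      case (elim z)
      let ?u = "fst z" and ?u' = "snd z"
      have "ennreal \<bar>quantile \<mu> ?u - quantile \<nu> ?u\<bar>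
          \<le> ennreal (\<bar>quantile \<mu> ?u - quantile \<mu> ?u'\<bar> + \<bar>quantile \<nu> ?u - quantile \<mu> ?u'\<bar>)"
        by (intro ennreal_leI) linarith
      also have "\<dots> = ennreal \<bar>quantile \<mu> ?u - quantile \<mu> ?u'\<bar>
          + ennreal \<bar>quantile \<nu> ?u - quantile \<mu> ?u'\<bar>"
        by simp
      also have "\<dots> \<le> ennreal \<bar>quantile \<mu> ?u - quantile \<mu> ?u'\<bar>
          + W1 (return borel (quantile \<nu> ?u)) (lifted_kernel \<mu> M ?u')"
        using W1_return_ge_mean[of "lifted_kernel \<mu> M ?u'" "quantile \<nu> ?u"] elim
        by (intro add_left_mono) simp
      also have "\<dots> \<le> ?c ?u ?u'"
        using elim by (simp add: add.assoc)
      finally show ?case .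
    qed
  qed
  finally show "(\<integral>\<^sup>+u. ennreal \<bar>quantile \<mu> u - quantile \<nu> u\<bar> \<partial>unif01) \<le> (\<integral>\<^sup>+(u, u'). ?c u u' \<partial>\<gamma>)"
    by (simp add: case_prod_unfold)
qed

text \<open>On the diagonal both \<open>|u - u'|\<close> and \<open>|F(u) - F(u')|\<close> vanish.\<close>

lemma lifted_AW1_HF_le:
  assumes \<mu>: "real_distribution \<mu>" and \<nu>: "real_distribution \<nu>"
    and p: "p \<in> unif01 \<rightarrow>\<^sub>M prob_algebra borel"
  shows "lifted_AW1 \<mu> (lifted_HF \<mu> \<nu>) (lifted \<mu> p)
    \<le> (\<integral>\<^sup>+u. \<integral>\<^sup>+y. ennreal \<bar>y - quantile \<nu> u\<bar> \<partial>p u \<partial>unif01)"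
proof -
  note [measurable] = measurable_quantile[OF \<nu>] measurable_prob_algebraD[OF p]
  define \<gamma> where "\<gamma> = distr unif01 (unif01 \<Otimes>\<^sub>M unif01) (\<lambda>u. (u, u))"
  have \<gamma>: "\<gamma> \<in> couplings unif01 unif01"
    unfolding couplings_def \<gamma>_def by (auto simp: distr_distr comp_def distr_id)
  let ?c = "\<lambda>u u'. ennreal \<bar>u - u'\<bar> + ennreal \<bar>quantile \<mu> u - quantile \<mu> u'\<bar>
    + W1 (lifted_kernel \<mu> (lifted_HF \<mu> \<nu>) u) (lifted_kernel \<mu> (lifted \<mu> p) u')"
  let ?d = "\<lambda>u. \<integral>\<^sup>+y. ennreal \<bar>y - quantile \<nu> u\<bar> \<partial>p u"
  have d: "?d \<in> borel_measurable unif01"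
    by (rule nn_integral_measurable_subprob_algebra2) measurable
  have diag: "AE z in \<gamma>. fst z = snd z"
    unfolding \<gamma>_def
  proof (subst AE_distr_iff)
    note [measurable] = measurable_compose[OF measurable_fst measurable_ident_unif01]
      measurable_compose[OF measurable_snd measurable_ident_unif01]
    show "{z \<in> space (unif01 \<Otimes>\<^sub>M unif01). fst z = snd z} \<in> sets (unif01 \<Otimes>\<^sub>M unif01)"
      by measurable
  qed auto
  have "AE u in unif01. W1 (lifted_kernel \<mu> (lifted_HF \<mu> \<nu>) u) (lifted_kernel \<mu> (lifted \<mu> p) u) \<le> ?d u"
    using lifted_HF_kernel_AE[OF \<mu> \<nu>] lifted_kernel_AE_eq[OF \<mu> p] AE_space
    by eventually_elim (use prob_kernelD[OF p] in \<open>auto intro!: W1_return_le\<close>)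
  from diag coupling_AE(1)[OF \<gamma> this]
  have le: "AE z in \<gamma>. ?c (fst z) (snd z) \<le> ?d (fst z)"
    by eventually_elim simp
  have "lifted_AW1 \<mu> (lifted_HF \<mu> \<nu>) (lifted \<mu> p) \<le> (\<integral>\<^sup>+(u, u'). ?c u u' \<partial>\<gamma>)"
    unfolding lifted_AW1_def by (rule INF_lower[OF \<gamma>])
  also have "\<dots> \<le> (\<integral>\<^sup>+z. ?d (fst z) \<partial>\<gamma>)"
    using le by (intro nn_integral_mono_AE) (simp add: case_prod_unfold)
  also have "\<dots> = (\<integral>\<^sup>+u. ?d u \<partial>unif01)"
    by (rule coupling_nn_integral_fst[OF \<gamma> d])
  finally show ?thesis .
qed

section \<open>Integrals against mixtures of two Dirac masses\<close>

text \<open>The description of the mixture on Borel sets extends to nonnegative Borel functions by the usual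
  monotone class induction.\<close>

lemma nn_integral_two_point_mixture:
  assumes sets: "sets M = sets borel"
    and w: "w \<in> borel_measurable K" "w' \<in> borel_measurable K" and g: "g \<in> borel_measurable K"
    and M: "\<And>A. A \<in> sets borel \<Longrightarrow>
      emeasure M A = (\<integral>\<^sup>+v. w v * indicator A (g v) + w' v * indicator A (c::real) \<partial>K)"
    and f: "f \<in> borel_measurable borel"
  shows "(\<integral>\<^sup>+y. f y \<partial>M) = (\<integral>\<^sup>+v. w v * f (g v) + w' v * f c \<partial>K)"
  using f
proof induction
  case (cong f h)
  then show ?case by (simp cong: nn_integral_cong)
next
  case (set A)
  then show ?case using sets M[of A] by simp
next
  case (mult f a)
  note [measurable] = mult.hyps w g
  note [measurable_cong] = sets
  have "(\<integral>\<^sup>+y. a * f y \<partial>M) = a * (\<integral>\<^sup>+v. w v * f (g v) + w' v * f c \<partial>K)"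
    by (simp add: nn_integral_cmult mult.IH)
  also have "\<dots> = (\<integral>\<^sup>+v. a * (w v * f (g v) + w' v * f c) \<partial>K)"
    by (rule nn_integral_cmult[symmetric]) measurable
  finally show ?case by (simp add: algebra_simps)
next
  case (add f h)
  note [measurable] = add.hyps w g
  note [measurable_cong] = sets
  have "(\<integral>\<^sup>+y. h y + f y \<partial>M)
      = (\<integral>\<^sup>+v. w v * h (g v) + w' v * h c \<partial>K) + (\<integral>\<^sup>+v. w v * f (g v) + w' v * f c \<partial>K)"
    by (simp add: nn_integral_add add.IH)
  also have "\<dots> = (\<integral>\<^sup>+v. (w v * h (g v) + w' v * h c) + (w v * f (g v) + w' v * f c) \<partial>K)"
    by (rule nn_integral_add[symmetric]) measurable
  finally show ?case by (simp add: algebra_simps)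
next
  case (seq U)
  note [measurable] = seq.hyps(1) w g
  note [measurable_cong] = sets
  have inc: "incseq (\<lambda>i. U i y)" for y
    using seq.hyps(3) by (auto simp: incseq_def le_fun_def)
  have "(\<integral>\<^sup>+y. (SUP i. U i) y \<partial>M) = (SUP i. \<integral>\<^sup>+y. U i y \<partial>M)"
    unfolding SUP_apply by (rule nn_integral_monotone_convergence_SUP[OF seq.hyps(3)]) measurable
  also have "\<dots> = (SUP i. \<integral>\<^sup>+v. w v * U i (g v) + w' v * U i c \<partial>K)"
    by (simp add: seq.IH)
  also have "\<dots> = (\<integral>\<^sup>+v. (SUP i. w v * U i (g v) + w' v * U i c) \<partial>K)"
    using inc by (intro nn_integral_monotone_convergence_SUP[symmetric])
      (auto simp: incseq_def le_fun_def intro!: add_mono mult_left_mono)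
  also have "\<dots> = (\<integral>\<^sup>+v. w v * (SUP i. U i) (g v) + w' v * (SUP i. U i) c \<partial>K)"
  proof (intro nn_integral_cong)
    fix v
    have "(SUP i. w v * U i (g v) + w' v * U i c) = (SUP i. w v * U i (g v)) + (SUP i. w' v * U i c)"
      using inc by (intro ennreal_SUP_add) (auto simp: incseq_def intro!: mult_left_mono)
    then show "(SUP i. w v * U i (g v) + w' v * U i c)
        = w v * (SUP i. U i) (g v) + w' v * (SUP i. U i) c"
      by (simp add: SUP_mult_left_ennreal image_comp)
  qed
  finally show ?case .
qed

section \<open>The two disintegrations of a coupling of the positive and negative parts\<close>

locale Q_kernel =
  fixes \<mu> \<nu> :: "real measure" and Q :: "(real \<times> real) measure" and \<kappa> :: "real \<Rightarrow> real measure"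
  assumes \<mu>: "real_distribution \<mu>" and \<nu>: "real_distribution \<nu>"
    and Q: "Q \<in> Qset \<mu> \<nu>" and Q_kernel: "is_Q_kernel \<mu> \<nu> Q \<kappa>"
begin

abbreviation F :: "real \<Rightarrow> real" where "F \<equiv> quantile \<mu>"
abbreviation G :: "real \<Rightarrow> real" where "G \<equiv> quantile \<nu>"

lemma measurable_FG [measurable]: "F \<in> borel_measurable unif01" "G \<in> borel_measurable unif01"
  by (rule measurable_quantile \<mu> \<nu>)+

lemma kernel: "\<kappa> \<in> unif01 \<rightarrow>\<^sub>M prob_algebra unif01"
  using Q_kernel by (simp add: is_Q_kernel_def)

lemmas kernel_subprob [measurable] = measurable_prob_algebraD[OF kernel]

lemma measurable_kernelI:
  "f \<in> unif01 \<rightarrow>\<^sub>M N \<Longrightarrow> u \<in> space unif01 \<Longrightarrow> f \<in> \<kappa> u \<rightarrow>\<^sub>M N"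
  by (simp cong: measurable_cong_sets add: prob_kernelD(2)[OF kernel])

lemma
  shows nn_integral_normalized_plus:
      "g \<in> borel_measurable unif01 \<Longrightarrow> (\<integral>\<^sup>+u. g u \<partial>normalized_dPsi_plus \<mu> \<nu>)
        = ennreal (1 / Psi_plus \<mu> \<nu> 1) * (\<integral>\<^sup>+u. ennreal (max 0 (F u - G u)) * g u \<partial>unif01)"
    and nn_integral_normalized_minus:
      "g \<in> borel_measurable unif01 \<Longrightarrow> (\<integral>\<^sup>+u. g u \<partial>normalized_dPsi_minus \<mu> \<nu>)
        = ennreal (1 / Psi_plus \<mu> \<nu> 1) * (\<integral>\<^sup>+u. ennreal (max 0 (G u - F u)) * g u \<partial>unif01)"
  unfolding normalized_dPsi_plus_def normalized_dPsi_minus_def dPsi_plus_def dPsi_minus_def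
  by (simp_all add: nn_integral_scale_measure nn_integral_density)

lemma nn_integral_Q:
  assumes f: "f \<in> borel_measurable (unif01 \<Otimes>\<^sub>M unif01)"
  shows nn_integral_Q_fst: "(\<integral>\<^sup>+z. f z \<partial>Q) = ennreal (1 / Psi_plus \<mu> \<nu> 1)
      * (\<integral>\<^sup>+u. ennreal (max 0 (F u - G u)) * (\<integral>\<^sup>+v. f (u, v) \<partial>\<kappa> u) \<partial>unif01)"
    and nn_integral_Q_snd: "(\<integral>\<^sup>+z. f z \<partial>Q) = ennreal (1 / Psi_plus \<mu> \<nu> 1)
      * (\<integral>\<^sup>+v. ennreal (max 0 (G v - F v)) * (\<integral>\<^sup>+u. f (u, v) \<partial>\<kappa> v) \<partial>unif01)"
proof -
  note [measurable] = f
  have s: "sets (normalized_dPsi_plus \<mu> \<nu>) = sets unif01"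
    "sets (normalized_dPsi_minus \<mu> \<nu>) = sets unif01"
    by (simp_all add: normalized_dPsi_plus_def normalized_dPsi_minus_def dPsi_plus_def dPsi_minus_def)
  have Q1: "Q = bind (normalized_dPsi_plus \<mu> \<nu>)
      (\<lambda>u. bind (\<kappa> u) (\<lambda>v. return (unif01 \<Otimes>\<^sub>M unif01) (u, v)))"
    and Q2: "Q = bind (normalized_dPsi_minus \<mu> \<nu>)
      (\<lambda>v. bind (\<kappa> v) (\<lambda>u. return (unif01 \<Otimes>\<^sub>M unif01) (u, v)))"
    using Q_kernel unfolding is_Q_kernel_def by blast+
  have "(\<integral>\<^sup>+z. f z \<partial>Q) = (\<integral>\<^sup>+u. \<integral>\<^sup>+v. f (u, v) \<partial>\<kappa> u \<partial>normalized_dPsi_plus \<mu> \<nu>)"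
    by (subst Q1, rule nn_integral_bind_return[OF s(1) kernel _ f]) measurable
  also have "\<dots> = ennreal (1 / Psi_plus \<mu> \<nu> 1)
      * (\<integral>\<^sup>+u. ennreal (max 0 (F u - G u)) * (\<integral>\<^sup>+v. f (u, v) \<partial>\<kappa> u) \<partial>unif01)"
    by (intro nn_integral_normalized_plus nn_integral_measurable_subprob_algebra2[OF _ kernel_subprob])
      measurable
  finally show "(\<integral>\<^sup>+z. f z \<partial>Q) = \<dots>" .
  have "(\<integral>\<^sup>+z. f z \<partial>Q) = (\<integral>\<^sup>+v. \<integral>\<^sup>+u. f (u, v) \<partial>\<kappa> v \<partial>normalized_dPsi_minus \<mu> \<nu>)"
    by (subst Q2, rule nn_integral_bind_return[OF s(2) kernel _ f]) measurable
  also have "\<dots> = ennreal (1 / Psi_plus \<mu> \<nu> 1)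
      * (\<integral>\<^sup>+v. ennreal (max 0 (G v - F v)) * (\<integral>\<^sup>+u. f (u, v) \<partial>\<kappa> v) \<partial>unif01)"
    by (intro nn_integral_normalized_minus nn_integral_measurable_subprob_algebra2[OF _ kernel_subprob])
      measurable
  finally show "(\<integral>\<^sup>+z. f z \<partial>Q) = \<dots>" .
qed

text \<open>A vanishing factor would make \<open>Q\<close> the null measure.\<close>

lemma normalizer_nonzero: "ennreal (1 / Psi_plus \<mu> \<nu> 1) \<noteq> 0"
proof
  assume "ennreal (1 / Psi_plus \<mu> \<nu> 1) = 0"
  then have "(\<integral>\<^sup>+z. 1 \<partial>Q) = 0"
    by (subst nn_integral_Q_fst) auto
  moreover have "prob_space Q"
    using Q by (simp add: Qset_def)
  ultimately show False
    using prob_space.emeasure_space_1[of Q] by simp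
qed

text \<open>Both sides are the integral of \<open>f\<close> against \<open>\<Psi>\<^sub>+(1) Q\<close>.\<close>

lemma disintegration_swap:
  assumes "f \<in> borel_measurable (unif01 \<Otimes>\<^sub>M unif01)"
  shows "(\<integral>\<^sup>+u. ennreal (max 0 (F u - G u)) * (\<integral>\<^sup>+v. f (u, v) \<partial>\<kappa> u) \<partial>unif01)
    = (\<integral>\<^sup>+v. ennreal (max 0 (G v - F v)) * (\<integral>\<^sup>+u. f (u, v) \<partial>\<kappa> v) \<partial>unif01)"
  using nn_integral_Q_fst[OF assms] nn_integral_Q_snd[OF assms] normalizer_nonzero
  by (simp add: ennreal_mult_cancel_left)

text \<open>An event of full \<open>Q\<close>-measure has full measure for almost every kernel, from either coordinate.
  The densities \<open>(F - G)\<^sup>+\<close> and \<open>(F - G)\<^sup>-\<close> are positive exactly where the conclusion is claimed, so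
  almost everywhere can refer to Lebesgue measure.\<close>

lemma Q_null_kernel:
  assumes D [measurable]: "Measurable.pred (unif01 \<Otimes>\<^sub>M unif01) D" and ae: "AE z in Q. D z"
  shows "AE u in unif01. G u < F u \<longrightarrow> (AE v in \<kappa> u. D (u, v))"
    and "AE v in unif01. F v < G v \<longrightarrow> (AE u in \<kappa> v. D (u, v))"
proof -
  let ?f = "\<lambda>z. if D z then 0 else 1 :: ennreal"
  have f [measurable]: "?f \<in> borel_measurable (unif01 \<Otimes>\<^sub>M unif01)"
    by measurable
  have "(\<integral>\<^sup>+z. ?f z \<partial>Q) = (\<integral>\<^sup>+z. 0 \<partial>Q)"
    by (intro nn_integral_cong_AE) (use ae in eventually_elim, auto)
  then have zero: "(\<integral>\<^sup>+u. ennreal (max 0 (F u - G u)) * (\<integral>\<^sup>+v. ?f (u, v) \<partial>\<kappa> u) \<partial>unif01) = 0"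
    "(\<integral>\<^sup>+v. ennreal (max 0 (G v - F v)) * (\<integral>\<^sup>+u. ?f (u, v) \<partial>\<kappa> v) \<partial>unif01) = 0"
    using nn_integral_Q[OF f] normalizer_nonzero by auto
  have m [measurable]: "(\<lambda>u. \<integral>\<^sup>+v. ?f (u, v) \<partial>\<kappa> u) \<in> borel_measurable unif01"
      "(\<lambda>v. \<integral>\<^sup>+u. ?f (u, v) \<partial>\<kappa> v) \<in> borel_measurable unif01"
    by (rule nn_integral_measurable_subprob_algebra2[OF _ kernel_subprob], measurable)+
  have ind: "AE y in \<kappa> x. R y"
    if x: "x \<in> space unif01" and R: "Measurable.pred unif01 R"
      and 0: "(\<integral>\<^sup>+y. (if R y then 0 else 1) \<partial>\<kappa> x) = 0" for x R
  proof -
    have "(\<lambda>y. if R y then 0 else 1 :: ennreal) \<in> borel_measurable (\<kappa> x)"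
      by (rule measurable_kernelI[OF _ x]) (use R in measurable)
    with 0 have "AE y in \<kappa> x. (if R y then 0 else 1) = (0::ennreal)"
      by (subst (asm) nn_integral_0_iff_AE) auto
    then show ?thesis
      by eventually_elim (auto split: if_splits)
  qed
  have "AE u in unif01. ennreal (max 0 (F u - G u)) * (\<integral>\<^sup>+v. ?f (u, v) \<partial>\<kappa> u) = 0"
    using zero(1) by (subst (asm) nn_integral_0_iff_AE) auto
  then show "AE u in unif01. G u < F u \<longrightarrow> (AE v in \<kappa> u. D (u, v))"
    using AE_space
  proof eventually_elim
    case (elim u)
    then have [measurable]: "u \<in> space unif01" by simp
    have "Measurable.pred unif01 (\<lambda>v. D (u, v))" by measurable
    with elim ind[of u "\<lambda>v. D (u, v)"] show ?case
      by auto
  qed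
  have "AE v in unif01. ennreal (max 0 (G v - F v)) * (\<integral>\<^sup>+u. ?f (u, v) \<partial>\<kappa> v) = 0"
    using zero(2) by (subst (asm) nn_integral_0_iff_AE) auto
  then show "AE v in unif01. F v < G v \<longrightarrow> (AE u in \<kappa> v. D (u, v))"
    using AE_space
  proof eventually_elim
    case (elim v)
    then have [measurable]: "v \<in> space unif01" by simp
    have "Measurable.pred unif01 (\<lambda>u. D (u, v))" by measurable
    with elim ind[of v "\<lambda>u. D (u, v)"] show ?case
      by auto
  qed
qed

text \<open>The disintegrations show that \<open>Q\<close> does not charge pairs at which the density of the respective
  marginal vanishes.\<close>

lemma AE_Q_ordered:
  "AE z in Q. fst z < snd z \<and> G (fst z) < F (fst z) \<and> F (snd z) < G (snd z)"
proof -
  have [measurable_cong]: "sets Q = sets (unif01 \<Otimes>\<^sub>M unif01)"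
    using Q by (simp add: Qset_def)
  let ?f = "\<lambda>z. if G (fst z) < F (fst z) then 0 else 1 :: ennreal"
  let ?g = "\<lambda>z. if F (snd z) < G (snd z) then 0 else 1 :: ennreal"
  have f: "?f \<in> borel_measurable (unif01 \<Otimes>\<^sub>M unif01)"
    and g: "?g \<in> borel_measurable (unif01 \<Otimes>\<^sub>M unif01)"
    by measurable
  have "(\<integral>\<^sup>+z. ?f z \<partial>Q) = ennreal (1 / Psi_plus \<mu> \<nu> 1) * (\<integral>\<^sup>+u. 0 \<partial>unif01)"
    unfolding nn_integral_Q_fst[OF f]
    by (intro arg_cong2[where f="(*)"] nn_integral_cong refl) (auto simp: max_def)
  then have "(\<integral>\<^sup>+z. ?f z \<partial>Q) = 0"
    by simp
  then have 1: "AE z in Q. ?f z = 0"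
    by (subst (asm) nn_integral_0_iff_AE) auto
  have "(\<integral>\<^sup>+z. ?g z \<partial>Q) = ennreal (1 / Psi_plus \<mu> \<nu> 1) * (\<integral>\<^sup>+u. 0 \<partial>unif01)"
    unfolding nn_integral_Q_snd[OF g]
    by (intro arg_cong2[where f="(*)"] nn_integral_cong refl) (auto simp: max_def)
  then have "(\<integral>\<^sup>+z. ?g z \<partial>Q) = 0"
    by simp
  then have 2: "AE z in Q. ?g z = 0"
    by (subst (asm) nn_integral_0_iff_AE) auto
  have "AE z in Q. fst z < snd z"
    using Q by (simp add: Qset_def case_prod_unfold)
  with 1 2 show ?thesis
    by eventually_elim (auto split: if_splits)
qed

text \<open>\<open>F(u)\<close> is a nontrivial convex combination of \<open>G(u)\<close> and \<open>G(v)\<close>.\<close>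

definition straddles :: "real \<Rightarrow> real \<Rightarrow> bool" where
  "straddles u v \<longleftrightarrow> G u < F u \<and> F u < G v \<or> G v < F u \<and> F u < G u"

text \<open>For \<open>G(u) < F(u)\<close> the chain \<open>G(u) < F(u) \<le> F(v) < G(v)\<close> holds for almost every \<open>v\<close>, the middle
  step because \<open>u < v\<close>. For \<open>F(u) < G(u)\<close> the kernel runs over the first coordinate of \<open>Q\<close> instead, and
  the chain is reversed.\<close>

lemma kernel_straddles: "AE u in unif01. F u \<noteq> G u \<longrightarrow> (AE v in \<kappa> u. straddles u v)"
proof -
  note [measurable] = measurable_compose[OF measurable_fst measurable_ident_unif01]
      measurable_compose[OF measurable_snd measurable_ident_unif01]
  let ?D = "\<lambda>z. fst z < snd z \<and> G (fst z) < F (fst z) \<and> F (snd z) < G (snd z)"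
  have D: "Measurable.pred (unif01 \<Otimes>\<^sub>M unif01) ?D" by measurable
  have mono: "F u \<le> F v" if "u \<in> {0<..<1}" "v \<in> {0<..<1}" "u < v" for u v
    using mono_onD[OF mono_on_quantile[OF \<mu>]] that by simp
  from Q_null_kernel[OF D AE_Q_ordered] AE_space
  show ?thesis
  proof eventually_elim
    case (elim u)
    then have u: "u \<in> {0<..<1}" by simp
    have sp: "AE v in \<kappa> u. v \<in> {0<..<1}"
      using AE_space[of "\<kappa> u"] prob_kernelD(3)[OF kernel, of u] u by (simp only: space_unif01)
    show ?case
    proof
      assume "F u \<noteq> G u"
      then consider "G u < F u" | "F u < G u" by linarith
      then show "AE v in \<kappa> u. straddles u v"
      proof cases
        case 1
        with elim have "AE v in \<kappa> u. ?D (u, v)" by blast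
        with sp show ?thesis
          by eventually_elim (use u mono in \<open>force simp: straddles_def\<close>)
      next
        case 2
        with elim have "AE v in \<kappa> u. ?D (v, u)" by blast
        with sp show ?thesis
          by eventually_elim (use u mono in \<open>force simp: straddles_def\<close>)
      qed
    qed
  qed
qed

section \<open>The kernel of the lifted martingale coupling\<close>

text \<open>If \<open>straddles u v\<close>, this is the mass that the two-point law with mean \<open>F(u)\<close> on \<open>G(u)\<close> and
  \<open>G(v)\<close> gives to \<open>G(v)\<close>.\<close>

definition weight :: "real \<Rightarrow> real \<Rightarrow> real" where
  "weight u v = (F u - G u) / (G v - G u)"

lemma straddles_weight:
  assumes "straddles u v"
  shows "0 \<le> weight u v" "weight u v \<le> 1" "weight u v * (G v - G u) = F u - G u"
    "(G v - F u) / (G v - G u) = 1 - weight u v"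
proof -
  have ne: "G v - G u \<noteq> 0"
    using assms by (auto simp: straddles_def)
  then show "weight u v * (G v - G u) = F u - G u"
    by (simp add: weight_def)
  have "(G v - F u) / (G v - G u) = ((G v - G u) - (F u - G u)) / (G v - G u)"
    by simp
  also have "\<dots> = 1 - weight u v"
    unfolding weight_def diff_divide_distrib[of "G v - G u"] using ne by simp
  finally show "(G v - F u) / (G v - G u) = 1 - weight u v" .
  show "0 \<le> weight u v" "weight u v \<le> 1"
    using assms by (auto simp: straddles_def weight_def field_simps)
qed

text \<open>For \<open>\<kappa>\<^sub>u\<close>-almost every \<open>v\<close> the weights lie in \<open>[0,1]\<close>, so the Bochner integral that defines the kernel is finite
  and agrees with a nonnegative integral.\<close>

lemma nn_integral_mtilde:
  assumes m: "is_mtilde \<mu> \<nu> \<kappa> m"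
  shows "AE u in unif01. F u \<noteq> G u \<longrightarrow> (\<forall>f\<in>borel_measurable borel. (\<integral>\<^sup>+y. f y \<partial>m u)
    = (\<integral>\<^sup>+v. ennreal (weight u v) * f (G v) + ennreal (1 - weight u v) * f (G u) \<partial>\<kappa> u))"
proof -
  from m have mk: "m \<in> unif01 \<rightarrow>\<^sub>M prob_algebra borel"
    and "AE u in unif01. F u \<noteq> G u \<longrightarrow> (\<forall>A\<in>sets borel. measure (m u) A =
      (\<integral>v. (F u - G u) / (G v - G u) * indicator A (G v)
          + (G v - F u) / (G v - G u) * indicator A (G u) \<partial>\<kappa> u))"
    by (auto simp: is_mtilde_def)
  from this(2) kernel_straddles AE_space
  show ?thesis
  proof eventually_elim
    case (elim u)
    show ?case
    proof (intro impI ballI)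
      assume ne: "F u \<noteq> G u"
      have u: "u \<in> space unif01" by fact
      have [measurable_cong]: "sets (\<kappa> u) = sets unif01" by (rule prob_kernelD[OF kernel u])
      interpret \<kappa>: prob_space "\<kappa> u" by (rule prob_kernelD[OF kernel u])
      interpret m: prob_space "m u" by (rule prob_kernelD[OF mk u])
      have st: "AE v in \<kappa> u. straddles u v" using elim ne by blast
      have [measurable]: "u \<in> space unif01" by (rule u)
      have G: "G \<in> borel_measurable (\<kappa> u)" by (rule measurable_kernelI[OF _ u]) measurable
      have W: "weight u \<in> borel_measurable (\<kappa> u)"
        by (rule measurable_kernelI[OF _ u]) (unfold weight_def, measurable)
      fix f :: "real \<Rightarrow> ennreal" assume f: "f \<in> borel_measurable borel"
      show "(\<integral>\<^sup>+y. f y \<partial>m u)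
        = (\<integral>\<^sup>+v. ennreal (weight u v) * f (G v) + ennreal (1 - weight u v) * f (G u) \<partial>\<kappa> u)"
      proof (rule nn_integral_two_point_mixture[OF _ _ _ G _ f])
        show "sets (m u) = sets borel" by (rule prob_kernelD[OF mk u])
        show "(\<lambda>v. ennreal (weight u v)) \<in> borel_measurable (\<kappa> u)"
          "(\<lambda>v. ennreal (1 - weight u v)) \<in> borel_measurable (\<kappa> u)"
          using W by auto
        fix A :: "real set" assume A [measurable]: "A \<in> sets borel"
        let ?h = "\<lambda>v. weight u v * indicator A (G v) + (1 - weight u v) * indicator A (G u)"
        have h: "?h \<in> borel_measurable (\<kappa> u)"
          using W measurable_compose[OF G borel_measurable_indicator[OF A]]
          by (intro borel_measurable_add borel_measurable_times borel_measurable_diff) auto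
        have bnd: "AE v in \<kappa> u. 0 \<le> ?h v \<and> ?h v \<le> 1"
          using st by eventually_elim (use straddles_weight in \<open>auto simp: indicator_def\<close>)
        have int: "integrable (\<kappa> u) ?h"
          by (rule \<kappa>.integrable_const_bound[of _ 1, OF _ h]) (use bnd in eventually_elim, auto)
        have "measure (m u) A = (\<integral>v. (F u - G u) / (G v - G u) * indicator A (G v)
          + (G v - F u) / (G v - G u) * indicator A (G u) \<partial>\<kappa> u)"
          using elim ne A by blast
        also have "\<dots> = (\<integral>v. ?h v \<partial>\<kappa> u)"
        proof (rule integral_cong_AE[OF _ h])
          have "(\<lambda>v. (F u - G u) / (G v - G u) * indicator A (G v)
              + (G v - F u) / (G v - G u) * indicator A (G u)) \<in> borel_measurable unif01"
            by measurable
          then show "(\<lambda>v. (F u - G u) / (G v - G u) * indicator A (G v)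
              + (G v - F u) / (G v - G u) * indicator A (G u)) \<in> borel_measurable (\<kappa> u)"
            by (rule measurable_kernelI[OF _ u])
          show "AE v in \<kappa> u. (F u - G u) / (G v - G u) * indicator A (G v)
              + (G v - F u) / (G v - G u) * indicator A (G u) = ?h v"
            using st by eventually_elim (simp add: straddles_weight(4), simp add: weight_def)
        qed
        finally have "emeasure (m u) A = ennreal (\<integral>v. ?h v \<partial>\<kappa> u)"
          by (simp add: m.emeasure_eq_measure)
        also have "\<dots> = (\<integral>\<^sup>+v. ennreal (?h v) \<partial>\<kappa> u)"
          using bnd by (intro nn_integral_eq_integral[symmetric] int) auto
        also have "\<dots> = (\<integral>\<^sup>+v. ennreal (weight u v) * indicator A (G v)
            + ennreal (1 - weight u v) * indicator A (G u) \<partial>\<kappa> u)"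
          by (intro nn_integral_cong_AE, use st in eventually_elim)
            (use straddles_weight in \<open>auto simp: indicator_def simp flip: ennreal_plus\<close>)
        finally show "emeasure (m u) A = (\<integral>\<^sup>+v. ennreal (weight u v) * indicator A (G v)
            + ennreal (1 - weight u v) * indicator A (G u) \<partial>\<kappa> u)" .
      qed
    qed
  qed
qed

text \<open>Averaging the deviation from \<open>G(u)\<close> leaves only the atoms at \<open>G(v)\<close>, each of which contributes
  \<open>weight u v * (G v - G u) = F u - G u\<close>, independently of \<open>v\<close>. Positive and negative parts are treated
  separately because integrability is one of the consequences; one of the two is always zero.\<close>

lemma mtilde_deviation:
  assumes m: "is_mtilde \<mu> \<nu> \<kappa> m"
  shows "AE u in unif01. (\<integral>\<^sup>+y. ennreal (y - G u) \<partial>m u) = ennreal (F u - G u)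
    \<and> (\<integral>\<^sup>+y. ennreal (G u - y) \<partial>m u) = ennreal (G u - F u)"
  using nn_integral_mtilde[OF m] kernel_straddles AE_space
proof eventually_elim
  case (elim u)
  have u: "u \<in> space unif01" by fact
  show ?case
  proof (cases "F u = G u")
    case True
    then have "m u = return borel (G u)"
      using m u by (simp add: is_mtilde_def)
    then show ?thesis
      using True by (simp add: nn_integral_return)
  next
    case False
    interpret \<kappa>: prob_space "\<kappa> u" by (rule prob_kernelD[OF kernel u])
    have st: "AE v in \<kappa> u. straddles u v" using elim False by blast
    have "(\<integral>\<^sup>+y. ennreal (y - G u) \<partial>m u)
        = (\<integral>\<^sup>+v. ennreal (weight u v) * ennreal (G v - G u)
            + ennreal (1 - weight u v) * ennreal (G u - G u) \<partial>\<kappa> u)"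
      by (rule elim(1)[rule_format, OF False]) measurable
    also have "\<dots> = (\<integral>\<^sup>+v. ennreal (F u - G u) \<partial>\<kappa> u)"
      by (intro nn_integral_cong_AE, use st in eventually_elim)
        (simp add: straddles_weight flip: ennreal_mult')
    also have "\<dots> = ennreal (F u - G u)"
      by (simp add: \<kappa>.emeasure_space_1)
    finally have 1: "(\<integral>\<^sup>+y. ennreal (y - G u) \<partial>m u) = ennreal (F u - G u)" .
    have "(\<integral>\<^sup>+y. ennreal (G u - y) \<partial>m u)
        = (\<integral>\<^sup>+v. ennreal (weight u v) * ennreal (G u - G v)
            + ennreal (1 - weight u v) * ennreal (G u - G u) \<partial>\<kappa> u)"
      by (rule elim(1)[rule_format, OF False]) measurable
    also have "\<dots> = (\<integral>\<^sup>+v. ennreal (G u - F u) \<partial>\<kappa> u)"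
    proof (intro nn_integral_cong_AE, use st in eventually_elim)
      fix v assume v: "straddles u v"
      have "weight u v * (G u - G v) = G u - F u"
        using straddles_weight(3)[OF v] by (simp add: algebra_simps)
      then show "ennreal (weight u v) * ennreal (G u - G v)
          + ennreal (1 - weight u v) * ennreal (G u - G u) = ennreal (G u - F u)"
        using straddles_weight(1)[OF v] by (simp flip: ennreal_mult')
    qed
    also have "\<dots> = ennreal (G u - F u)"
      by (simp add: \<kappa>.emeasure_space_1)
    finally show ?thesis using 1 by simp
  qed
qed

lemma mtilde_cost:
  assumes m: "is_mtilde \<mu> \<nu> \<kappa> m"
  shows "AE u in unif01. (\<integral>\<^sup>+y. ennreal \<bar>y - G u\<bar> \<partial>m u) = ennreal \<bar>F u - G u\<bar>"
  using mtilde_deviation[OF m] AE_space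
proof eventually_elim
  case (elim u)
  have mk: "m \<in> unif01 \<rightarrow>\<^sub>M prob_algebra borel"
    using m by (simp add: is_mtilde_def)
  note [measurable_cong] = prob_kernelD(2)[OF mk elim(2)]
  have abs: "ennreal \<bar>x\<bar> = ennreal x + ennreal (- x)" for x
    by (cases "0 \<le> x") (auto simp: ennreal_neg)
  have "(\<integral>\<^sup>+y. ennreal \<bar>y - G u\<bar> \<partial>m u)
      = (\<integral>\<^sup>+y. ennreal (y - G u) \<partial>m u) + (\<integral>\<^sup>+y. ennreal (G u - y) \<partial>m u)"
    by (subst abs, subst nn_integral_add) auto
  with elim abs[of "F u - G u"] show ?case by simp
qed

lemma mtilde_martingale:
  assumes m: "is_mtilde \<mu> \<nu> \<kappa> m"
  shows "AE u in unif01. integrable (m u) (\<lambda>y. y) \<and> (\<integral>y. y \<partial>m u) = F u"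
  using mtilde_deviation[OF m] mtilde_cost[OF m] AE_space
proof eventually_elim
  case (elim u)
  have mk: "m \<in> unif01 \<rightarrow>\<^sub>M prob_algebra borel"
    using m by (simp add: is_mtilde_def)
  note [measurable_cong] = prob_kernelD(2)[OF mk elim(3)]
  interpret m: prob_space "m u" by (rule prob_kernelD(1)[OF mk elim(3)])
  have int: "integrable (m u) (\<lambda>y. y - G u)"
    using elim(2) by (intro integrableI_bounded) auto
  then have "integrable (m u) (\<lambda>y. (y - G u) + G u)"
    by (intro Bochner_Integration.integrable_add) auto
  then have "integrable (m u) (\<lambda>y. y)" by simp
  moreover have "(\<integral>y. y - G u \<partial>m u) = F u - G u"
    using elim(1) by (subst real_lebesgue_integral_def[OF int])
      (cases "F u \<le> G u"; simp add: ennreal_neg)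
  ultimately show ?case
    by (simp add: m.prob_space)
qed

text \<open>Start from a unit mass at \<open>G(u)\<close> and spread it according to \<open>m\<^sub>u\<close>. For \<open>G(u) < F(u)\<close> let \<open>b(u)\<close> be the
  part of the moving mass that starts in \<open>A\<close> and \<open>a(u)\<close> the part that ends in \<open>A\<close>; for \<open>F(u) < G(u)\<close> these
  parts are \<open>a'(u)\<close> and \<open>b'(u)\<close>. Hence \<open>m\<^sub>u(A) + b(u) + a'(u) = \<delta>\<^bsub>G(u)\<^esub>(A) + a(u) + b'(u)\<close> for almost all
  \<open>u\<close>. Since \<open>a\<close> and \<open>a'\<close> integrate the same function of the pair, and likewise \<open>b\<close> and \<open>b'\<close>, swapping the
  disintegrations equates their integrals. These are finite, as the masses are at most 1, and cancel;
  what remains is the law of \<open>G\<close>, which is \<open>\<nu>\<close>.\<close>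

lemma mtilde_marginal:
  assumes m: "is_mtilde \<mu> \<nu> \<kappa> m" and A [measurable]: "A \<in> sets borel"
  shows "(\<integral>\<^sup>+u. emeasure (m u) A \<partial>unif01) = emeasure \<nu> A"
proof -
  have mk: "m \<in> unif01 \<rightarrow>\<^sub>M prob_algebra borel"
    using m by (simp add: is_mtilde_def)
  note [measurable] = measurable_prob_algebraD[OF mk]
  let ?h = "\<lambda>y. indicator A y :: ennreal"
  let ?k = "\<lambda>u v. ennreal (1 / (G v - G u))"
  \<comment> \<open>Where \<open>G(u) < F(u)\<close>, the product \<open>(F(u) - G(u))\<^sup>+ / (G(v) - G(u))\<close> is \<open>weight u v\<close>. In \<open>a'\<close> and \<open>b'\<close> the
    first coordinate \<open>u\<close> of the pair is integrated, and the weight is that of the pair \<open>(v, u)\<close>.\<close>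
  define a where "a u = ennreal (max 0 (F u - G u)) * (\<integral>\<^sup>+v. ?k u v * ?h (G v) \<partial>\<kappa> u)" for u
  define b where "b u = ennreal (max 0 (F u - G u)) * (\<integral>\<^sup>+v. ?k u v * ?h (G u) \<partial>\<kappa> u)" for u
  define a' where "a' v = ennreal (max 0 (G v - F v)) * (\<integral>\<^sup>+u. ?k u v * ?h (G v) \<partial>\<kappa> v)" for v
  define b' where "b' v = ennreal (max 0 (G v - F v)) * (\<integral>\<^sup>+u. ?k u v * ?h (G u) \<partial>\<kappa> v)" for v
  have swap: "(\<integral>\<^sup>+u. a u \<partial>unif01) = (\<integral>\<^sup>+v. a' v \<partial>unif01)"
      "(\<integral>\<^sup>+u. b u \<partial>unif01) = (\<integral>\<^sup>+v. b' v \<partial>unif01)"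
    unfolding a_def a'_def b_def b'_def
    using disintegration_swap[of "\<lambda>z. ?k (fst z) (snd z) * ?h (G (snd z))"]
      disintegration_swap[of "\<lambda>z. ?k (fst z) (snd z) * ?h (G (fst z))"] by simp_all
  have [measurable]: "(\<lambda>u. \<integral>\<^sup>+v. ?k u v * ?h (G v) \<partial>\<kappa> u) \<in> borel_measurable unif01"
      "(\<lambda>u. \<integral>\<^sup>+v. ?k u v * ?h (G u) \<partial>\<kappa> u) \<in> borel_measurable unif01"
      "(\<lambda>v. \<integral>\<^sup>+u. ?k u v * ?h (G v) \<partial>\<kappa> v) \<in> borel_measurable unif01"
      "(\<lambda>v. \<integral>\<^sup>+u. ?k u v * ?h (G u) \<partial>\<kappa> v) \<in> borel_measurable unif01"
    by (rule nn_integral_measurable_subprob_algebra2[OF _ kernel_subprob], measurable)+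
  have [measurable]: "a \<in> borel_measurable unif01" "a' \<in> borel_measurable unif01"
      "b \<in> borel_measurable unif01" "b' \<in> borel_measurable unif01"
    unfolding a_def a'_def b_def b'_def by measurable
  have ae: "AE u in unif01. emeasure (m u) A + b u + a' u = ?h (G u) + a u + b' u \<and> a u \<le> 1 \<and> b u \<le> 1"
    using nn_integral_mtilde[OF m] kernel_straddles AE_space
  proof eventually_elim
    case (elim u)
    have u [measurable]: "u \<in> space unif01" by fact
    interpret \<kappa>: prob_space "\<kappa> u" by (rule prob_kernelD[OF kernel u])
    show ?case
    proof (cases "F u = G u")
      case True
      then have "m u = return borel (G u)"
        using m u by (simp add: is_mtilde_def)
      then show ?thesis
        using True by (simp add: a_def b_def a'_def b'_def)
    next
      case False
      have st: "AE v in \<kappa> u. straddles u v" using elim False by blast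
      let ?w = "\<lambda>v. ennreal (weight u v)" and ?w' = "\<lambda>v. ennreal (1 - weight u v)"
      have "weight u \<in> borel_measurable (\<kappa> u)"
        by (rule measurable_kernelI[OF _ u]) (unfold weight_def, measurable)
      moreover have "G \<in> borel_measurable (\<kappa> u)"
        by (rule measurable_kernelI[OF _ u]) measurable
      ultimately have ms: "?w \<in> borel_measurable (\<kappa> u)" "?w' \<in> borel_measurable (\<kappa> u)"
          "(\<lambda>v. ?h (G v)) \<in> borel_measurable (\<kappa> u)"
        by (simp_all add: measurable_compose[OF _ borel_measurable_indicator[OF A]])
      have ms': "(\<lambda>v. ?k u v * ?h (G v)) \<in> borel_measurable (\<kappa> u)"
        "(\<lambda>v. ?k u v * ?h (G u)) \<in> borel_measurable (\<kappa> u)"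
        "(\<lambda>v. ?k v u * ?h (G v)) \<in> borel_measurable (\<kappa> u)"
        "(\<lambda>v. ?k v u * ?h (G u)) \<in> borel_measurable (\<kappa> u)"
        by (rule measurable_kernelI[OF _ u], measurable)+
      have "emeasure (m u) A = (\<integral>\<^sup>+y. ?h y \<partial>m u)"
        using prob_kernelD(2)[OF mk u] A by simp
      also have "\<dots> = (\<integral>\<^sup>+v. ?w v * ?h (G v) + ?w' v * ?h (G u) \<partial>\<kappa> u)"
        by (rule elim(1)[rule_format, OF False]) measurable
      finally have mA: "emeasure (m u) A = \<dots>" .
      have "emeasure (m u) A + (\<integral>\<^sup>+v. ?w v * ?h (G u) \<partial>\<kappa> u)
          = (\<integral>\<^sup>+v. ?w v * ?h (G v) + ?w' v * ?h (G u) + ?w v * ?h (G u) \<partial>\<kappa> u)"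
        unfolding mA using ms by (intro nn_integral_add[symmetric]) auto
      also have "\<dots> = (\<integral>\<^sup>+v. ?h (G u) + ?w v * ?h (G v) \<partial>\<kappa> u)"
      proof (intro nn_integral_cong_AE, use st in eventually_elim)
        fix v assume "straddles u v"
        then have "?w' v + ?w v = 1"
          using straddles_weight[of u v] by (simp flip: ennreal_plus)
        then have "?w' v * ?h (G u) + ?w v * ?h (G u) = ?h (G u)"
          by (simp only: distrib_right[symmetric] mult_1)
        then show "?w v * ?h (G v) + ?w' v * ?h (G u) + ?w v * ?h (G u) = ?h (G u) + ?w v * ?h (G v)"
          by (metis (no_types) add.assoc add.commute)
      qed
      also have "\<dots> = ?h (G u) + (\<integral>\<^sup>+v. ?w v * ?h (G v) \<partial>\<kappa> u)"
        using ms by (subst nn_integral_add) (auto simp: \<kappa>.emeasure_space_1)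
      finally have key: "emeasure (m u) A + (\<integral>\<^sup>+v. ?w v * ?h (G u) \<partial>\<kappa> u)
          = ?h (G u) + (\<integral>\<^sup>+v. ?w v * ?h (G v) \<partial>\<kappa> u)" .
      have le1: "(\<integral>\<^sup>+v. ?w v * ?h (r v) \<partial>\<kappa> u) \<le> 1" for r
      proof -
        have "(\<integral>\<^sup>+v. ?w v * ?h (r v) \<partial>\<kappa> u) \<le> (\<integral>\<^sup>+v. 1 \<partial>\<kappa> u)"
          by (intro nn_integral_mono_AE, use st in eventually_elim)
            (use straddles_weight in \<open>auto simp: indicator_def\<close>)
        then show ?thesis by (simp add: \<kappa>.emeasure_space_1)
      qed
      consider "G u < F u" | "F u < G u" using False by linarith
      then show ?thesis
      proof cases
        case 1
        have w: "ennreal (F u - G u) * ?k u v = ?w v" for v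
          using 1 by (simp add: weight_def flip: ennreal_mult')
        have "a u = (\<integral>\<^sup>+v. ?w v * ?h (G v) \<partial>\<kappa> u)"
          unfolding a_def using 1 nn_integral_cmult[OF ms'(1)] by (simp flip: w add: mult.assoc)
        moreover have "b u = (\<integral>\<^sup>+v. ?w v * ?h (G u) \<partial>\<kappa> u)"
          unfolding b_def using 1 nn_integral_cmult[OF ms'(2)] by (simp flip: w add: mult.assoc)
        moreover have "a' u = 0" "b' u = 0"
          using 1 by (simp_all add: a'_def b'_def max_def)
        ultimately show ?thesis using key le1[of G] le1[of "\<lambda>_. G u"] by simp
      next
        case 2
        have w: "ennreal (G u - F u) * ?k v u = ?w v" for v
        proof -
          have "(G u - F u) * (1 / (G u - G v)) = weight u v"
            unfolding weight_def by (simp add: minus_divide_divide[of "F u - G u" "G v - G u", symmetric])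
          then show ?thesis
            using 2 by (simp flip: ennreal_mult')
        qed
        have "b' u = (\<integral>\<^sup>+v. ?w v * ?h (G v) \<partial>\<kappa> u)"
          unfolding b'_def using 2 nn_integral_cmult[OF ms'(3)] by (simp flip: w add: mult.assoc)
        moreover have "a' u = (\<integral>\<^sup>+v. ?w v * ?h (G u) \<partial>\<kappa> u)"
          unfolding a'_def using 2 nn_integral_cmult[OF ms'(4)] by (simp flip: w add: mult.assoc)
        moreover have "a u = 0" "b u = 0"
          using 2 by (simp_all add: a_def b_def max_def)
        ultimately show ?thesis using key by simp
      qed
    qed
  qed
  have le1: "(\<integral>\<^sup>+u. g u \<partial>unif01) \<le> 1" if "AE u in unif01. g u \<le> 1" for g
    using nn_integral_mono_AE[OF that] by (simp add: unif01.emeasure_space_1[simplified])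
  have "(\<integral>\<^sup>+u. a u \<partial>unif01) \<le> 1" "(\<integral>\<^sup>+u. b u \<partial>unif01) \<le> 1"
    using ae by (auto intro!: le1)
  then have fin: "(\<integral>\<^sup>+u. a u \<partial>unif01) + (\<integral>\<^sup>+u. b u \<partial>unif01) \<noteq> \<infinity>"
    by (auto simp: top_unique)
  have "(\<integral>\<^sup>+u. emeasure (m u) A + b u + a' u \<partial>unif01) = (\<integral>\<^sup>+u. ?h (G u) + a u + b' u \<partial>unif01)"
    using ae by (intro nn_integral_cong_AE) auto
  then have "(\<integral>\<^sup>+u. emeasure (m u) A \<partial>unif01) + (\<integral>\<^sup>+u. b u \<partial>unif01) + (\<integral>\<^sup>+u. a' u \<partial>unif01)
      = (\<integral>\<^sup>+u. ?h (G u) \<partial>unif01) + (\<integral>\<^sup>+u. a u \<partial>unif01) + (\<integral>\<^sup>+u. b' u \<partial>unif01)"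
    by (simp add: nn_integral_add)
  then have "(\<integral>\<^sup>+u. a u \<partial>unif01) + (\<integral>\<^sup>+u. b u \<partial>unif01) + (\<integral>\<^sup>+u. emeasure (m u) A \<partial>unif01)
      = (\<integral>\<^sup>+u. a u \<partial>unif01) + (\<integral>\<^sup>+u. b u \<partial>unif01) + (\<integral>\<^sup>+u. ?h (G u) \<partial>unif01)"
    by (simp add: swap[symmetric] ac_simps)
  with fin have "(\<integral>\<^sup>+u. emeasure (m u) A \<partial>unif01) = (\<integral>\<^sup>+u. ?h (G u) \<partial>unif01)"
    by (simp add: ennreal_add_left_cancel)
  also have "\<dots> = (\<integral>\<^sup>+x. ?h x \<partial>distr unif01 borel G)"
    by (rule nn_integral_distr[symmetric]) auto
  also have "\<dots> = emeasure \<nu> A"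
    using A real_distribution.events_eq_borel[OF \<nu>] by (simp add: distr_quantile[OF \<nu>])
  finally show ?thesis .
qed

lemma lifted_mtilde_in_martingale_couplings:
  assumes m: "is_mtilde \<mu> \<nu> \<kappa> m"
  shows "lifted \<mu> m \<in> lifted_martingale_couplings \<mu> \<nu>"
proof -
  have mk: "m \<in> unif01 \<rightarrow>\<^sub>M prob_algebra borel"
    using m by (simp add: is_mtilde_def)
  have "distr (lifted \<mu> m) borel (\<lambda>(u, x, y). y) = \<nu>"
    by (rule measure_eqI)
      (simp_all add: emeasure_third_marginal_lifted[OF \<mu> mk] mtilde_marginal[OF m]
        real_distribution.events_eq_borel[OF \<nu>])
  with mk mtilde_martingale[OF m] show ?thesis
    unfolding lifted_martingale_couplings_def by blast
qed

lemma lifted_AW1_mtilde_le: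
  assumes m: "is_mtilde \<mu> \<nu> \<kappa> m"
  shows "lifted_AW1 \<mu> (lifted_HF \<mu> \<nu>) (lifted \<mu> m) \<le> (\<integral>\<^sup>+u. ennreal \<bar>F u - G u\<bar> \<partial>unif01)"
proof -
  have mk: "m \<in> unif01 \<rightarrow>\<^sub>M prob_algebra borel"
    using m by (simp add: is_mtilde_def)
  have "(\<integral>\<^sup>+u. \<integral>\<^sup>+y. ennreal \<bar>y - G u\<bar> \<partial>m u \<partial>unif01) = (\<integral>\<^sup>+u. ennreal \<bar>F u - G u\<bar> \<partial>unif01)"
    by (rule nn_integral_cong_AE[OF mtilde_cost[OF m]])
  then show ?thesis
    using lifted_AW1_HF_le[OF \<mu> \<nu> mk] by simp
qed

end

section \<open>Optimality\<close>

theorem proposition3p1: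
  fixes \<mu> \<nu> :: "real measure"
  assumes "\<mu> \<in> P1" and "\<nu> \<in> P1" and "convex_order \<mu> \<nu>" and "\<mu> \<noteq> \<nu>"
  shows "\<forall>Q\<in>Qset \<mu> \<nu>. \<forall>\<kappa> m. is_Q_kernel \<mu> \<nu> Q \<kappa> \<longrightarrow> is_mtilde \<mu> \<nu> \<kappa> m \<longrightarrow>
    lifted_martingale_rearrangement \<mu> \<nu> (lifted_HF \<mu> \<nu>) (lifted \<mu> m)
    \<and> lifted_AW1 \<mu> (lifted_HF \<mu> \<nu>) (lifted \<mu> m)
        = (INF M\<in>lifted_martingale_couplings \<mu> \<nu>. lifted_AW1 \<mu> (lifted_HF \<mu> \<nu>) M)"
proof (intro ballI allI impI)
  fix Q \<kappa> m assume Q: "Q \<in> Qset \<mu> \<nu>" "is_Q_kernel \<mu> \<nu> Q \<kappa>" and m: "is_mtilde \<mu> \<nu> \<kappa> m"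
  have \<mu>: "real_distribution \<mu>" and \<nu>: "real_distribution \<nu>"
    using assms by (simp_all add: P1_def)
  interpret Q_kernel \<mu> \<nu> Q \<kappa>
    by (intro Q_kernel.intro \<mu> \<nu> Q)
  let ?AW = "lifted_AW1 \<mu> (lifted_HF \<mu> \<nu>)" and ?\<M> = "lifted_martingale_couplings \<mu> \<nu>"
  have mem: "lifted \<mu> m \<in> ?\<M>"
    by (rule lifted_mtilde_in_martingale_couplings[OF m])
  have min: "?AW (lifted \<mu> m) \<le> ?AW M" if "M \<in> ?\<M>" for M
    using lifted_AW1_mtilde_le[OF m] lifted_AW1_HF_ge[OF \<mu> \<nu> that] by (rule order_trans)
  have "lifted_martingale_rearrangement \<mu> \<nu> (lifted_HF \<mu> \<nu>) (lifted \<mu> m)"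
    unfolding lifted_martingale_rearrangement_def is_arg_min_def
    using lifted_HF_in_couplings[OF \<mu> \<nu>] mem min by (auto simp: not_less)
  moreover have "?AW (lifted \<mu> m) = (INF M\<in>?\<M>. ?AW M)"
    by (intro antisym INF_greatest INF_lower min mem)
  ultimately show "lifted_martingale_rearrangement \<mu> \<nu> (lifted_HF \<mu> \<nu>) (lifted \<mu> m)
      \<and> ?AW (lifted \<mu> m) = (INF M\<in>?\<M>. ?AW M)" ..
qed

end
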